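(* Let $(L,U,d,\rho)$ be a local vertex Lie algebra over $U$ and let $\lambda$ be a linear character (linear functional) of $U^{0}=\ker d$. Then $V(L,\lambda)$ is a quotient vertex algebra of $V(L)$.
   Context: All vector spaces are over $\mathbb{C}$; $\mathbb{N}=\{0,1,2,\dots\}$. Put $\Delta^{(k)}(x,y)=(\partial/\partial x)^{k}\sum_{n\in\mathbb{Z}}x^{n}y^{-n-1}$ for $k\in\mathbb{N}$. Local vertex Lie algebra: a quadruple $(L,U,d,\rho)$ where $L$ is a Lie algebra, $U$ is a vector space (the base space), $d$ is a partially defined linear map from $U$ to $U$ (a linear map $\mathrm{dom}(d)\to U$ on a subspace $\mathrm{dom}(d)\subseteq U$), and $\rho: U\otimes\mathbb{C}[t,t^{-1}]\to L$ is a surjective linear map with $\ker\rho=\mathrm{im}\,\hat d$, where $\hat d=d\otimes 1+1\otimes \frac{d}{dt}$ is defined on $\mathrm{dom}(d)\otimes\mathbb{C}[t,t^{-1}]$; moreover, writing $u(n)=\rho(u\otimes t^{n})$, $u(x)=\sum_{n\in\mathbb{Z}}u(n)x^{-n-1}$ and $u^{(i)}(x)=(\frac{d}{dx})^{i}u(x)$, for any $u,v\in U$ there exist finitely many $f_0,\dots,f_r\in U$ and $k_0,\dots,k_r,l_0,\dots,l_r\in\mathbb{N}$ (all depending on $u,v$) such that $[u(x),v(y)]=\sum_{i=0}^{r}f_i^{(k_i)}(y)\Delta^{(l_i)}(x,y)$. $L^{+}=\rho(U\otimes\mathbb{C}[t])$ is a Lie subalgebra of $L$, and $V(L)=U(L)\otimes_{U(L^{+})}\mathbb{C}$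 is the $L$-module induced from the trivial one-dimensional $L^{+}$-module, with $\mathbf{1}=1\otimes1$. $V(L)$ carries a natural vertex algebra structure with vacuum $\mathbf{1}$ and $Y(u(-1)\mathbf{1},z)=\sum_{n\in\mathbb{Z}}u(n)z^{-n-1}$ for $u\in U$. The map $u\mapsto u(-1)$ is injective on $U$, and $U^{0}(-1)=\{u(-1): u\in U^{0}\}$ is a central subalgebra of $L$; a linear functional $\lambda$ on $U^{0}$ is identified with one on $U^{0}(-1)$ by $\lambda(u(-1))=\lambda(u)$. $V(L,\lambda)$ is the quotient $L$-module of $V(L)$ by the submodule generated by the vectors $c\cdot\mathbf{1}-\lambda(c)\mathbf{1}$ for $c\in U^{0}(-1)$. "Quotient vertex algebra" means that this submodule is an ideal of the vertex algebra $V(L)$, so that $V(L,\lambda)$ inherits the vertex algebra structure. *)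

theory Defs
  imports
    "HOL-Algebra.Module"
    "HOL-Algebra.QuotRing"
    "HOL-Algebra.Free_Abelian_Groups"
    "HOL-Algebra.Algebraic_Closure_Type"
begin

section \<open>Complex vector spaces and Lie algebras\<close>

text \<open>A complex vector space is a HOL-Algebra module \<open>M\<close> over the field \<open>CC\<close>; the
  record fields \<open>mult\<close> and \<open>one\<close> of \<open>M\<close> are irrelevant, and are left
  undefined in the modules constructed below.\<close>

abbreviation CC :: "complex ring" where
  "CC \<equiv> ring_of_type_algebra"

definition linear_map ::
    "(complex, 'a) module \<Rightarrow> (complex, 'b) module \<Rightarrow> ('a \<Rightarrow> 'b) \<Rightarrow> bool" where
  "linear_map M N f \<longleftrightarrow>
     f \<in> carrier M \<rightarrow> carrier N \<and>
     (\<forall>x\<in>carrier M. \<forall>y\<in>carrier M. f (x \<oplus>\<^bsub>M\<^esub> y) = f x \<oplus>\<^bsub>N\<^esub> f y) \<and>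
     (\<forall>c. \<forall>x\<in>carrier M. f (c \<odot>\<^bsub>M\<^esub> x) = c \<odot>\<^bsub>N\<^esub> f x)"

definition linear_functional :: "(complex, 'a) module \<Rightarrow> ('a \<Rightarrow> complex) \<Rightarrow> bool" where
  "linear_functional M f \<longleftrightarrow>
     (\<forall>x\<in>carrier M. \<forall>y\<in>carrier M. f (x \<oplus>\<^bsub>M\<^esub> y) = f x + f y) \<and>
     (\<forall>c. \<forall>x\<in>carrier M. f (c \<odot>\<^bsub>M\<^esub> x) = c * f x)"

definition quot_module :: "(complex, 'a) module \<Rightarrow> 'a set \<Rightarrow> (complex, 'a set) module" where
  "quot_module M W =
     \<lparr>carrier = a_rcosets\<^bsub>M\<^esub> W, monoid.mult = undefined, one = undefined,
      zero = W, add = set_add M,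
      module.smult = (\<lambda>c A. \<Union>x\<in>A. W +>\<^bsub>M\<^esub> (c \<odot>\<^bsub>M\<^esub> x))\<rparr>"

locale lie_algebra = module CC L for L :: "(complex, 'l) module" (structure) +
  fixes br :: "'l \<Rightarrow> 'l \<Rightarrow> 'l"
  assumes br_closed: "\<lbrakk>x \<in> carrier L; y \<in> carrier L\<rbrakk> \<Longrightarrow> br x y \<in> carrier L"
    and br_add_left: "\<lbrakk>x \<in> carrier L; y \<in> carrier L; z \<in> carrier L\<rbrakk>
          \<Longrightarrow> br (x \<oplus> y) z = br x z \<oplus> br y z"
    and br_add_right: "\<lbrakk>x \<in> carrier L; y \<in> carrier L; z \<in> carrier L\<rbrakk>
          \<Longrightarrow> br x (y \<oplus> z) = br x y \<oplus> br x z"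
    and br_smult_left: "\<lbrakk>x \<in> carrier L; y \<in> carrier L\<rbrakk> \<Longrightarrow> br (c \<odot> x) y = c \<odot> br x y"
    and br_smult_right: "\<lbrakk>x \<in> carrier L; y \<in> carrier L\<rbrakk> \<Longrightarrow> br x (c \<odot> y) = c \<odot> br x y"
    and br_self: "x \<in> carrier L \<Longrightarrow> br x x = \<zero>"
    and br_jacobi: "\<lbrakk>x \<in> carrier L; y \<in> carrier L; z \<in> carrier L\<rbrakk>
          \<Longrightarrow> br x (br y z) \<oplus> br y (br z x) \<oplus> br z (br x y) = \<zero>"


section \<open>Formal distributions\<close>

text \<open>A formal distribution in \<open>x\<close> is the function mapping \<open>m\<close> to the coefficient of
  \<open>x\<^sup>m\<close>; one in \<open>x, y\<close> maps \<open>m\<close>, \<open>n\<close> to the coefficient of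
  \<open>x\<^sup>m y\<^sup>n\<close>.\<close>

definition fd_deriv :: "(complex, 'l) module \<Rightarrow> (int \<Rightarrow> 'l) \<Rightarrow> int \<Rightarrow> 'l" where
  "fd_deriv L f m = of_int (m + 1) \<odot>\<^bsub>L\<^esub> f (m + 1)"

definition fd_pderiv_x :: "(int \<Rightarrow> int \<Rightarrow> complex) \<Rightarrow> int \<Rightarrow> int \<Rightarrow> complex" where
  "fd_pderiv_x g m n = of_int (m + 1) * g (m + 1) n"

definition fd_Delta :: "nat \<Rightarrow> int \<Rightarrow> int \<Rightarrow> complex" where
  "fd_Delta k = (fd_pderiv_x ^^ k) (\<lambda>m n. if n = - m - 1 then 1 else 0)"

text \<open>The product \<open>f(y) g(x,y)\<close>. It is only used for \<open>g\<close> such that the sum over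
  \<open>j\<close> is finite, which is the case for every \<^term>\<open>fd_Delta k\<close>.\<close>

definition fd_mult_y ::
    "(complex, 'l) module \<Rightarrow> (int \<Rightarrow> 'l) \<Rightarrow> (int \<Rightarrow> int \<Rightarrow> complex) \<Rightarrow> int \<Rightarrow> int \<Rightarrow> 'l" where
  "fd_mult_y L f g m n = finsum L (\<lambda>j. g m (n - j) \<odot>\<^bsub>L\<^esub> f j) {j. g m (n - j) \<noteq> 0}"


section \<open>Local vertex Lie algebras\<close>

text \<open>\<open>U \<otimes> \<complex>[t,t\<^sup>-\<^sup>1]\<close>, as the space of Laurent polynomials with coefficients in \<open>U\<close>
  (a function mapping \<open>n\<close> to the coefficient of \<open>t\<^sup>n\<close>).\<close>

definition laurent :: "(complex, 'u) module \<Rightarrow> (complex, int \<Rightarrow> 'u) module" where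
  "laurent U =
     \<lparr>carrier = {p. (\<forall>n. p n \<in> carrier U) \<and> finite {n. p n \<noteq> \<zero>\<^bsub>U\<^esub>}},
      monoid.mult = undefined, one = undefined,
      zero = (\<lambda>n. \<zero>\<^bsub>U\<^esub>), add = (\<lambda>p q n. p n \<oplus>\<^bsub>U\<^esub> q n),
      module.smult = (\<lambda>c p n. c \<odot>\<^bsub>U\<^esub> p n)\<rparr>"

definition lmonom :: "(complex, 'u) module \<Rightarrow> 'u \<Rightarrow> int \<Rightarrow> int \<Rightarrow> 'u" where
  "lmonom U u n = (\<lambda>m. if m = n then u else \<zero>\<^bsub>U\<^esub>)"

text \<open>\<open>d \<otimes> 1 + 1 \<otimes> d/dt\<close>\<close>

definition dhat :: "(complex, 'u) module \<Rightarrow> ('u \<Rightarrow> 'u) \<Rightarrow> (int \<Rightarrow> 'u) \<Rightarrow> int \<Rightarrow> 'u" where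
  "dhat U d p = (\<lambda>n. d (p n) \<oplus>\<^bsub>U\<^esub> (of_int (n + 1) \<odot>\<^bsub>U\<^esub> p (n + 1)))"

definition umode ::
    "(complex, 'u) module \<Rightarrow> ((int \<Rightarrow> 'u) \<Rightarrow> 'l) \<Rightarrow> 'u \<Rightarrow> int \<Rightarrow> 'l" where
  "umode U \<rho> u n = \<rho> (lmonom U u n)"

text \<open>\<open>u(x) = \<Sum>n. u(n) x\<^sup>-\<^sup>n\<^sup>-\<^sup>1\<close>\<close>

definition ufield ::
    "(complex, 'u) module \<Rightarrow> ((int \<Rightarrow> 'u) \<Rightarrow> 'l) \<Rightarrow> 'u \<Rightarrow> int \<Rightarrow> 'l" where
  "ufield U \<rho> u m = umode U \<rho> u (- m - 1)"

text \<open>The partially defined map is given by its domain \<open>dom_d\<close> and a function \<open>d\<close>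
  whose values outside \<open>dom_d\<close> are irrelevant.\<close>

locale local_vertex_lie_algebra =
  L: lie_algebra L br + U: module CC U
  for L :: "(complex, 'l) module" and br :: "'l \<Rightarrow> 'l \<Rightarrow> 'l"
    and U :: "(complex, 'u) module" +
  fixes dom_d :: "'u set" and d :: "'u \<Rightarrow> 'u" and \<rho> :: "(int \<Rightarrow> 'u) \<Rightarrow> 'l"
  assumes dom_d: "submodule dom_d CC U"
    and d_linear: "linear_map (U\<lparr>carrier := dom_d\<rparr>) U d"
    and rho_linear: "linear_map (laurent U) L \<rho>"
    and rho_surj: "\<rho> ` carrier (laurent U) = carrier L"
    and rho_ker: "{p \<in> carrier (laurent U). \<rho> p = \<zero>\<^bsub>L\<^esub>} =
                    dhat U d ` carrier (laurent (U\<lparr>carrier := dom_d\<rparr>))"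
    and locality: "\<lbrakk>u \<in> carrier U; v \<in> carrier U\<rbrakk> \<Longrightarrow>
          \<exists>(r::nat) (f :: nat \<Rightarrow> 'u) (k :: nat \<Rightarrow> nat) (l :: nat \<Rightarrow> nat).
            (\<forall>i\<le>r. f i \<in> carrier U) \<and>
            (\<forall>m n. br (ufield U \<rho> u m) (ufield U \<rho> v n) =
               finsum L (\<lambda>i. fd_mult_y L ((fd_deriv L ^^ k i) (ufield U \<rho> (f i)))
                              (fd_Delta (l i)) m n) {..r})"

definition ker_d :: "(complex, 'u) module \<Rightarrow> 'u set \<Rightarrow> ('u \<Rightarrow> 'u) \<Rightarrow> 'u set" where
  "ker_d U dom_d d = {u \<in> dom_d. d u = \<zero>\<^bsub>U\<^esub>}"

definition Lplus :: "(complex, 'u) module \<Rightarrow> ((int \<Rightarrow> 'u) \<Rightarrow> 'l) \<Rightarrow> 'l set" where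
  "Lplus U \<rho> = \<rho> ` {p \<in> carrier (laurent U). \<forall>n<0. p n = \<zero>\<^bsub>U\<^esub>}"


section \<open>Universal enveloping algebras\<close>

text \<open>The free associative unital algebra on a set: finitely supported functions on words,
  with the concatenation product.\<close>

definition free_algebra :: "'g set \<Rightarrow> ('g list \<Rightarrow> complex) ring" where
  "free_algebra S =
     \<lparr>carrier = {p. finite {w. p w \<noteq> 0} \<and> {w. p w \<noteq> 0} \<subseteq> lists S},
      monoid.mult = (\<lambda>p q w. \<Sum>k\<le>length w. p (take k w) * q (drop k w)),
      one = (\<lambda>w. if w = [] then 1 else 0),
      zero = (\<lambda>w. 0), add = (\<lambda>p q w. p w + q w)\<rparr>"

definition fmonom :: "complex \<Rightarrow> 'g list \<Rightarrow> 'g list \<Rightarrow> complex" where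
  "fmonom c v = (\<lambda>w. if w = v then c else 0)"

text \<open>The first two families of relations cut the free algebra on the set \<open>L\<close> down to the
  tensor algebra of the vector space \<open>L\<close>; the third one imposes \<open>x y - y x = [x,y]\<close>.\<close>

definition uea_rels :: "(complex, 'l) module \<Rightarrow> ('l \<Rightarrow> 'l \<Rightarrow> 'l) \<Rightarrow> ('l list \<Rightarrow> complex) set" where
  "uea_rels L br =
     {fmonom 1 [x \<oplus>\<^bsub>L\<^esub> y] \<ominus>\<^bsub>F\<^esub> fmonom 1 [x] \<ominus>\<^bsub>F\<^esub> fmonom 1 [y] | F x y.
        F = free_algebra (carrier L) \<and> x \<in> carrier L \<and> y \<in> carrier L} \<union>
     {fmonom 1 [c \<odot>\<^bsub>L\<^esub> x] \<ominus>\<^bsub>F\<^esub> fmonom c [x] | F c x.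
        F = free_algebra (carrier L) \<and> x \<in> carrier L} \<union>
     {fmonom 1 [x, y] \<ominus>\<^bsub>F\<^esub> fmonom 1 [y, x] \<ominus>\<^bsub>F\<^esub> fmonom 1 [br x y] | F x y.
        F = free_algebra (carrier L) \<and> x \<in> carrier L \<and> y \<in> carrier L}"

definition uea_ideal :: "(complex, 'l) module \<Rightarrow> ('l \<Rightarrow> 'l \<Rightarrow> 'l) \<Rightarrow> ('l list \<Rightarrow> complex) set" where
  "uea_ideal L br = Idl\<^bsub>free_algebra (carrier L)\<^esub> (uea_rels L br)"

definition uea :: "(complex, 'l) module \<Rightarrow> ('l \<Rightarrow> 'l \<Rightarrow> 'l) \<Rightarrow> ('l list \<Rightarrow> complex) set ring" where
  "uea L br = free_algebra (carrier L) Quot uea_ideal L br"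

definition uea_class ::
    "(complex, 'l) module \<Rightarrow> ('l \<Rightarrow> 'l \<Rightarrow> 'l) \<Rightarrow> ('l list \<Rightarrow> complex) \<Rightarrow> ('l list \<Rightarrow> complex) set" where
  "uea_class L br p = uea_ideal L br +>\<^bsub>free_algebra (carrier L)\<^esub> p"

text \<open>The canonical homomorphism \<open>U(H) \<rightarrow> U(L)\<close> for a Lie subalgebra \<open>H\<close> of \<open>L\<close>, applied
  to an element \<open>b\<close> of \<open>U(H)\<close>, that is, a coset.\<close>

definition uea_incl ::
    "(complex, 'l) module \<Rightarrow> ('l \<Rightarrow> 'l \<Rightarrow> 'l) \<Rightarrow> ('l list \<Rightarrow> complex) set \<Rightarrow> ('l list \<Rightarrow> complex) set" where
  "uea_incl L br b = (\<Union>p\<in>b. uea_class L br p)"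

text \<open>The scalar by which an element of a universal enveloping algebra acts on the trivial
  one-dimensional module: elements of the Lie algebra act by zero, so only the constant
  coefficient, which is the same for all representatives, contributes.\<close>

definition uea_counit :: "('l list \<Rightarrow> complex) set \<Rightarrow> complex" where
  "uea_counit b = the_elem ((\<lambda>p. p []) ` b)"


section \<open>Tensor products over a ring and induced modules\<close>

text \<open>\<open>M \<otimes>\<^sub>B N\<close> for a right module \<open>M\<close> and a left module \<open>N\<close> over a ring with carrier
  \<open>B\<close>, with actions \<open>ract\<close> and \<open>lact\<close>: the free abelian group on \<open>M \<times> N\<close> modulo
  the biadditivity and balancing relations.\<close>

definition tensor_rels ::
    "('m, 'x) ring_scheme \<Rightarrow> ('n, 'y) ring_scheme \<Rightarrow> 'b set \<Rightarrow>
     ('m \<Rightarrow> 'b \<Rightarrow> 'm) \<Rightarrow> ('b \<Rightarrow> 'n \<Rightarrow> 'n) \<Rightarrow> ('m \<times> 'n \<Rightarrow>\<^sub>0 int) set" where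
  "tensor_rels M N B ract lact =
     {frag_of (a \<oplus>\<^bsub>M\<^esub> a', z) - frag_of (a, z) - frag_of (a', z) | a a' z.
        a \<in> carrier M \<and> a' \<in> carrier M \<and> z \<in> carrier N} \<union>
     {frag_of (a, z \<oplus>\<^bsub>N\<^esub> z') - frag_of (a, z) - frag_of (a, z') | a z z'.
        a \<in> carrier M \<and> z \<in> carrier N \<and> z' \<in> carrier N} \<union>
     {frag_of (ract a b, z) - frag_of (a, lact b z) | a b z.
        a \<in> carrier M \<and> b \<in> B \<and> z \<in> carrier N}"

definition induced_kernel ::
    "(complex, 'l) module \<Rightarrow> ('l \<Rightarrow> 'l \<Rightarrow> 'l) \<Rightarrow> 'l set \<Rightarrow>
     (('l list \<Rightarrow> complex) set \<times> complex \<Rightarrow>\<^sub>0 int) set" where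
  "induced_kernel L br H =
     generate (free_Abelian_group (carrier (uea L br) \<times> carrier CC))
       (tensor_rels (uea L br) CC (carrier (uea (L\<lparr>carrier := H\<rparr>) br))
          (\<lambda>a b. a \<otimes>\<^bsub>uea L br\<^esub> uea_incl L br b) (\<lambda>b z. uea_counit b * z))"

definition induced_class ::
    "(complex, 'l) module \<Rightarrow> ('l \<Rightarrow> 'l \<Rightarrow> 'l) \<Rightarrow> 'l set \<Rightarrow>
     (('l list \<Rightarrow> complex) set \<times> complex \<Rightarrow>\<^sub>0 int) \<Rightarrow>
     (('l list \<Rightarrow> complex) set \<times> complex \<Rightarrow>\<^sub>0 int) set" where
  "induced_class L br H p =
     induced_kernel L br H #>\<^bsub>free_Abelian_group (carrier (uea L br) \<times> carrier CC)\<^esub> p"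

text \<open>The map of \<open>U(L) \<otimes>\<^bsub>U(H)\<^esub> \<complex>\<close> sending each \<open>a \<otimes> z\<close> to \<open>a' \<otimes> z'\<close>, where
  \<open>(a', z') = h (a, z)\<close>.\<close>

definition induced_map ::
    "(complex, 'l) module \<Rightarrow> ('l \<Rightarrow> 'l \<Rightarrow> 'l) \<Rightarrow> 'l set \<Rightarrow>
     (('l list \<Rightarrow> complex) set \<times> complex \<Rightarrow> ('l list \<Rightarrow> complex) set \<times> complex) \<Rightarrow>
     (('l list \<Rightarrow> complex) set \<times> complex \<Rightarrow>\<^sub>0 int) set \<Rightarrow>
     (('l list \<Rightarrow> complex) set \<times> complex \<Rightarrow>\<^sub>0 int) set" where
  "induced_map L br H h A = (\<Union>p\<in>A. induced_class L br H (frag_extend (\<lambda>q. frag_of (h q)) p))"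

type_synonym 'l induced = "(('l list \<Rightarrow> complex) set \<times> complex \<Rightarrow>\<^sub>0 int) set"

text \<open>\<open>U(L) \<otimes>\<^bsub>U(H)\<^esub> \<complex>\<close> as a vector space, the \<open>L\<close>-action on it, and \<open>1 \<otimes> 1\<close>.\<close>

definition induced_module ::
    "(complex, 'l) module \<Rightarrow> ('l \<Rightarrow> 'l \<Rightarrow> 'l) \<Rightarrow> 'l set \<Rightarrow> (complex, 'l induced) module" where
  "induced_module L br H =
     (let T = free_Abelian_group (carrier (uea L br) \<times> carrier CC) Mod induced_kernel L br H
      in \<lparr>carrier = carrier T, monoid.mult = undefined, one = undefined,
          zero = \<one>\<^bsub>T\<^esub>, add = monoid.mult T,
          module.smult = (\<lambda>c. induced_map L br H (\<lambda>(a, z). (a, c * z)))\<rparr>)"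

definition induced_act ::
    "(complex, 'l) module \<Rightarrow> ('l \<Rightarrow> 'l \<Rightarrow> 'l) \<Rightarrow> 'l set \<Rightarrow> 'l \<Rightarrow> 'l induced \<Rightarrow> 'l induced" where
  "induced_act L br H x =
     induced_map L br H (\<lambda>(a, z). (uea_class L br (fmonom 1 [x]) \<otimes>\<^bsub>uea L br\<^esub> a, z))"

definition induced_vec ::
    "(complex, 'l) module \<Rightarrow> ('l \<Rightarrow> 'l \<Rightarrow> 'l) \<Rightarrow> 'l set \<Rightarrow> 'l induced" where
  "induced_vec L br H = induced_class L br H (frag_of (\<one>\<^bsub>uea L br\<^esub>, 1))"


section \<open>Vertex algebras\<close>

text \<open>\<open>Y a n b\<close> is \<open>a\<^sub>n b\<close>, where \<open>Y(a,z) = \<Sum>n. a\<^sub>n z\<^sup>-\<^sup>n\<^sup>-\<^sup>1\<close>.\<close>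

text \<open>The sum of a finitely supported family.\<close>

definition fin_supp_sum :: "(complex, 'v) module \<Rightarrow> (nat \<Rightarrow> 'v) \<Rightarrow> 'v" where
  "fin_supp_sum V f = finsum V f {i. f i \<noteq> \<zero>\<^bsub>V\<^esub>}"

text \<open>The axiom \<open>borcherds\<close> is the coefficient of
  \<open>x\<^sub>0\<^sup>-\<^sup>l\<^sup>-\<^sup>1 x\<^sub>1\<^sup>-\<^sup>m\<^sup>-\<^sup>1 x\<^sub>2\<^sup>-\<^sup>n\<^sup>-\<^sup>1\<close> in the Jacobi identity
  \<open>x\<^sub>0\<^sup>-\<^sup>1 \<delta>((x\<^sub>1 - x\<^sub>2)/x\<^sub>0) Y(a,x\<^sub>1) Y(b,x\<^sub>2) -
   x\<^sub>0\<^sup>-\<^sup>1 \<delta>((x\<^sub>2 - x\<^sub>1)/(-x\<^sub>0)) Y(b,x\<^sub>2) Y(a,x\<^sub>1) =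
   x\<^sub>2\<^sup>-\<^sup>1 \<delta>((x\<^sub>1 - x\<^sub>0)/x\<^sub>2) Y(Y(a,x\<^sub>0)b,x\<^sub>2)\<close> applied to \<open>c\<close>. By
  \<open>truncation\<close> the sums are finite.\<close>

locale vertex_algebra = module CC V for V :: "(complex, 'v) module" (structure) +
  fixes Y :: "'v \<Rightarrow> int \<Rightarrow> 'v \<Rightarrow> 'v" and vac :: 'v
  assumes vac_closed: "vac \<in> carrier V"
    and Y_closed: "\<lbrakk>a \<in> carrier V; b \<in> carrier V\<rbrakk> \<Longrightarrow> Y a n b \<in> carrier V"
    and Y_add_left: "\<lbrakk>a \<in> carrier V; a' \<in> carrier V; b \<in> carrier V\<rbrakk>
          \<Longrightarrow> Y (a \<oplus> a') n b = Y a n b \<oplus> Y a' n b"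
    and Y_add_right: "\<lbrakk>a \<in> carrier V; b \<in> carrier V; b' \<in> carrier V\<rbrakk>
          \<Longrightarrow> Y a n (b \<oplus> b') = Y a n b \<oplus> Y a n b'"
    and Y_smult_left: "\<lbrakk>a \<in> carrier V; b \<in> carrier V\<rbrakk> \<Longrightarrow> Y (s \<odot> a) n b = s \<odot> Y a n b"
    and Y_smult_right: "\<lbrakk>a \<in> carrier V; b \<in> carrier V\<rbrakk> \<Longrightarrow> Y a n (s \<odot> b) = s \<odot> Y a n b"
    and truncation: "\<lbrakk>a \<in> carrier V; b \<in> carrier V\<rbrakk> \<Longrightarrow> \<exists>N. \<forall>n\<ge>N. Y a n b = \<zero>"
    and vacuum: "a \<in> carrier V \<Longrightarrow> Y vac n a = (if n = -1 then a else \<zero>)"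
    and creation: "a \<in> carrier V \<Longrightarrow> Y a (-1) vac = a"
    and creation_nonneg: "\<lbrakk>a \<in> carrier V; n \<ge> 0\<rbrakk> \<Longrightarrow> Y a n vac = \<zero>"
    and borcherds: "\<lbrakk>a \<in> carrier V; b \<in> carrier V; c \<in> carrier V\<rbrakk> \<Longrightarrow>
          fin_supp_sum V (\<lambda>i. (of_int m gchoose i) \<odot> Y (Y a (l + int i) b) (m + n - int i) c) =
          fin_supp_sum V (\<lambda>i. ((- 1) ^ i * (of_int l gchoose i)) \<odot>
            (Y a (l + m - int i) (Y b (n + int i) c) \<ominus>
             ((- 1) powi l) \<odot> Y b (l + n - int i) (Y a (m + int i) c)))"

definition va_ideal :: "(complex, 'v) module \<Rightarrow> ('v \<Rightarrow> int \<Rightarrow> 'v \<Rightarrow> 'v) \<Rightarrow> 'v set \<Rightarrow> bool" where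
  "va_ideal V Y W \<longleftrightarrow>
     submodule W CC V \<and>
     (\<forall>a\<in>carrier V. \<forall>w\<in>W. \<forall>n. Y a n w \<in> W \<and> Y w n a \<in> W)"

definition quot_Y ::
    "(complex, 'v) module \<Rightarrow> ('v \<Rightarrow> int \<Rightarrow> 'v \<Rightarrow> 'v) \<Rightarrow> 'v set \<Rightarrow> 'v set \<Rightarrow> int \<Rightarrow> 'v set \<Rightarrow> 'v set" where
  "quot_Y V Y W A n B = (\<Union>a\<in>A. \<Union>b\<in>B. W +>\<^bsub>V\<^esub> Y a n b)"


section \<open>The modules \<open>V(L)\<close> and \<open>V(L,\<lambda>)\<close>\<close>

definition VL ::
    "(complex, 'l) module \<Rightarrow> ('l \<Rightarrow> 'l \<Rightarrow> 'l) \<Rightarrow> (complex, 'u) module \<Rightarrow> ((int \<Rightarrow> 'u) \<Rightarrow> 'l) \<Rightarrow>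
     (complex, 'l induced) module" where
  "VL L br U \<rho> = induced_module L br (Lplus U \<rho>)"

definition VL_act ::
    "(complex, 'l) module \<Rightarrow> ('l \<Rightarrow> 'l \<Rightarrow> 'l) \<Rightarrow> (complex, 'u) module \<Rightarrow> ((int \<Rightarrow> 'u) \<Rightarrow> 'l) \<Rightarrow>
     'l \<Rightarrow> 'l induced \<Rightarrow> 'l induced" where
  "VL_act L br U \<rho> = induced_act L br (Lplus U \<rho>)"

definition VL_vac ::
    "(complex, 'l) module \<Rightarrow> ('l \<Rightarrow> 'l \<Rightarrow> 'l) \<Rightarrow> (complex, 'u) module \<Rightarrow> ((int \<Rightarrow> 'u) \<Rightarrow> 'l) \<Rightarrow>
     'l induced" where
  "VL_vac L br U \<rho> = induced_vec L br (Lplus U \<rho>)"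

text \<open>The submodule of an \<open>L\<close>-module \<open>V\<close> with action \<open>act\<close> generated by a set.\<close>

definition lie_submodule_gen ::
    "(complex, 'l) module \<Rightarrow> (complex, 'v) module \<Rightarrow> ('l \<Rightarrow> 'v \<Rightarrow> 'v) \<Rightarrow> 'v set \<Rightarrow> 'v set" where
  "lie_submodule_gen L V act S =
     \<Inter>{N. submodule N CC V \<and> (\<forall>x\<in>carrier L. \<forall>v\<in>N. act x v \<in> N) \<and> S \<subseteq> N}"

definition VL_lambda_sub ::
    "(complex, 'l) module \<Rightarrow> ('l \<Rightarrow> 'l \<Rightarrow> 'l) \<Rightarrow> (complex, 'u) module \<Rightarrow> 'u set \<Rightarrow> ('u \<Rightarrow> 'u) \<Rightarrow>
     ((int \<Rightarrow> 'u) \<Rightarrow> 'l) \<Rightarrow> ('u \<Rightarrow> complex) \<Rightarrow> 'l induced set" where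
  "VL_lambda_sub L br U dom_d d \<rho> lam =
     lie_submodule_gen L (VL L br U \<rho>) (VL_act L br U \<rho>)
       {VL_act L br U \<rho> (umode U \<rho> u (-1)) (VL_vac L br U \<rho>)
          \<ominus>\<^bsub>VL L br U \<rho>\<^esub> (lam u \<odot>\<^bsub>VL L br U \<rho>\<^esub> VL_vac L br U \<rho>) | u. u \<in> ker_d U dom_d d}"

text \<open>The underlying vector space of \<open>V(L,\<lambda>)\<close>; the kernel of the projection is \<open>L\<close>-stable,
  so the \<open>L\<close>-action is the one induced by \<^const>\<open>VL_act\<close>. A functional on \<open>U\<^sup>0\<close> is read as one
  on \<open>U\<^sup>0(-1)\<close> via \<open>u \<mapsto> u(-1)\<close>.\<close>

definition VL_lambda ::
    "(complex, 'l) module \<Rightarrow> ('l \<Rightarrow> 'l \<Rightarrow> 'l) \<Rightarrow> (complex, 'u) module \<Rightarrow> 'u set \<Rightarrow> ('u \<Rightarrow> 'u) \<Rightarrow>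
     ((int \<Rightarrow> 'u) \<Rightarrow> 'l) \<Rightarrow> ('u \<Rightarrow> complex) \<Rightarrow> (complex, 'l induced set) module" where
  "VL_lambda L br U dom_d d \<rho> lam =
     quot_module (VL L br U \<rho>) (VL_lambda_sub L br U dom_d d \<rho> lam)"

text \<open>The vertex algebra structures on \<open>V(L)\<close> with vacuum \<open>1 \<otimes> 1\<close> and
  \<open>Y(u(-1)1, z) = \<Sum>n. u(n) z\<^sup>-\<^sup>n\<^sup>-\<^sup>1\<close>. Since the vectors \<open>u(-1)1\<close> generate \<open>V(L)\<close>, these
  conditions determine \<open>Y\<close> on \<open>V(L)\<close>.\<close>

definition is_VL_vertex_structure ::
    "(complex, 'l) module \<Rightarrow> ('l \<Rightarrow> 'l \<Rightarrow> 'l) \<Rightarrow> (complex, 'u) module \<Rightarrow> ((int \<Rightarrow> 'u) \<Rightarrow> 'l) \<Rightarrow>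
     ('l induced \<Rightarrow> int \<Rightarrow> 'l induced \<Rightarrow> 'l induced) \<Rightarrow> bool" where
  "is_VL_vertex_structure L br U \<rho> Y \<longleftrightarrow>
     vertex_algebra (VL L br U \<rho>) Y (VL_vac L br U \<rho>) \<and>
     (\<forall>u\<in>carrier U. \<forall>n. \<forall>v\<in>carrier (VL L br U \<rho>).
        Y (VL_act L br U \<rho> (umode U \<rho> u (-1)) (VL_vac L br U \<rho>)) n v =
        VL_act L br U \<rho> (umode U \<rho> u n) v)"

end

theory Submission
  imports Defs
begin

text \<open>Write \<open>V\<close> for \<open>V(L)\<close> and \<open>W\<close> for the submodule generated by the vectors
  \<open>c\<cdot>1 - \<lambda>(c) 1\<close> with \<open>c = u(-1)\<close>, \<open>u \<in> ker d\<close>. The products of a vertex algebra pass to the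
  quotient by any ideal, and every axiom is inherited, because the coset map is linear and
  both sides of the Borcherds identity are finite sums (\<open>quotient_vertex_algebra\<close>). So the point is
  that \<open>W\<close> is stable under products with arbitrary vectors on both sides.

  Everything about arbitrary vectors is reduced to the generating fields \<open>u(z)\<close> by one principle:
  \<open>V\<close> is generated by the vacuum under the modes \<open>u(n)\<close> (\<open>induced_cyclic\<close>, \<open>cyclic\<close>), so a subspace
  that contains the vacuum and is stable under all modes is \<open>V\<close>. The Borcherds identity
  with \<open>m = 0\<close> expresses \<open>(a\<^sub>l b)\<^sub>n c\<close> through iterated products \<open>a\<^sub>i (b\<^sub>j c)\<close> and \<open>b\<^sub>i (a\<^sub>j c)\<close>
  (\<open>iterate_mem_submodule\<close>). As \<open>W\<close> is stable under the modes, the vectors \<open>a\<close> with \<open>a\<^sub>n W \<subseteq> W\<close> for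
  all \<open>n\<close> form such a subspace, and thus \<open>V\<^sub>n W \<subseteq> W\<close> (\<open>Y_W_right\<close>).

  For the other side, the vectors \<open>w \<in> W\<close> with \<open>w\<^sub>n V \<subseteq> W\<close> form, for the same reason, a submodule,
  and it is enough to see that it contains the generators of \<open>W\<close> (\<open>Y_W_left\<close>). Since \<open>d u = 0\<close>,
  the modes \<open>u(n)\<close> with \<open>n \<noteq> -1\<close> vanish in \<open>L\<close> (\<open>mode_ker_d\<close>), so the field of
  \<open>u(-1)1 - \<lambda>(u) 1\<close> is the constant \<open>u(-1) - \<lambda>(u)\<close>. This operator maps the vacuum into \<open>W\<close> and
  commutes with all modes: the commutator formula expresses the commutator through the products
  \<open>u(i) v(-1) 1\<close>, \<open>i \<ge> 0\<close>, which are zero. Hence it maps all of \<open>V\<close> into \<open>W\<close> (\<open>central_shift_mem\<close>).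

  Cyclicity of \<open>V\<close> is read off from the construction \<open>U(L) \<otimes> \<complex>\<close>, where the tensor product is a
  quotient of a free abelian group. A scalar \<open>s \<in> U(L)\<close> must be moved
  across the tensor sign, and for that it has to be the image of an element of \<open>U(L\<^sup>+)\<close> with counit \<open>s\<close>.
  That the counit and the map \<open>U(L\<^sup>+) \<rightarrow> U(L)\<close> are well defined rests on \<open>L\<^sup>+\<close> being a
  Lie subalgebra, which follows from locality (\<open>Lplus_bracket\<close>).\<close>

section \<open>Complex vector spaces and finitely supported sums\<close>

lemma carrier_CC [simp]: "carrier CC = UNIV"
  and add_CC [simp]: "x \<oplus>\<^bsub>CC\<^esub> y = x + y"
  and mult_CC [simp]: "x \<otimes>\<^bsub>CC\<^esub> y = x * y"
  and zero_CC [simp]: "\<zero>\<^bsub>CC\<^esub> = 0"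
  and one_CC [simp]: "\<one>\<^bsub>CC\<^esub> = 1"
  by (simp_all add: ring_of_type_algebra_def)

lemma (in module) minus_smult:
  "\<lbrakk>c \<in> carrier R; x \<in> carrier M\<rbrakk> \<Longrightarrow> y \<ominus>\<^bsub>M\<^esub> c \<odot>\<^bsub>M\<^esub> x = y \<oplus>\<^bsub>M\<^esub> (\<ominus> c) \<odot>\<^bsub>M\<^esub> x"
  by (simp add: a_minus_def smult_l_minus)

lemma a_inv_CC [simp]: "\<ominus>\<^bsub>CC\<^esub> c = - c"
proof -
  interpret cring CC by (rule cring_from_type_algebra)
  show ?thesis by (rule minus_equality) simp_all
qed

text \<open>Over a ring with one, negatives come from multiplication with \<open>-1\<close>, and zero
  from multiplication with \<open>0\<close>.\<close>

lemma (in module) submoduleI_add_smult: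
  assumes "N \<subseteq> carrier M" "N \<noteq> {}"
    and add: "\<And>x y. \<lbrakk>x \<in> N; y \<in> N\<rbrakk> \<Longrightarrow> x \<oplus>\<^bsub>M\<^esub> y \<in> N"
    and smult: "\<And>c x. \<lbrakk>c \<in> carrier R; x \<in> N\<rbrakk> \<Longrightarrow> c \<odot>\<^bsub>M\<^esub> x \<in> N"
  shows "submodule N R M"
proof (rule submoduleI)
  obtain x where x: "x \<in> N" using assms(2) by blast
  then have "\<zero> \<odot>\<^bsub>M\<^esub> x \<in> N" by (intro smult) simp_all
  then show "\<zero>\<^bsub>M\<^esub> \<in> N" using x assms(1) by (simp add: subsetD)
  fix y assume y: "y \<in> N"
  then have "(\<ominus> \<one>) \<odot>\<^bsub>M\<^esub> y \<in> N" by (intro smult) simp_all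
  then show "\<ominus>\<^bsub>M\<^esub> y \<in> N" using y assms(1) smult_l_minus[of \<one> y] by (simp add: subsetD)
qed (use assms in auto)

text \<open>The index set may be infinite: the sum is then zero by convention.\<close>

lemma submodule_finsum_closed:
  assumes "module CC V" "submodule W CC V" "\<And>i. i \<in> A \<Longrightarrow> f i \<in> W"
  shows "finsum V f A \<in> W"
proof -
  interpret V: module CC V by fact
  note W = V.submoduleE[OF assms(2)]
  have zW: "\<zero>\<^bsub>V\<^esub> \<in> W"
    using W(1-3) W(5) V.r_neg by (metis all_not_in_conv subsetD)
  have "finite A \<Longrightarrow> (\<And>i. i \<in> A \<Longrightarrow> f i \<in> W) \<Longrightarrow> finsum V f A \<in> W"
  proof (induction A rule: finite_induct)
    case (insert x F)
    then show ?case using W(1) W(5) by (subst V.finsum_insert) auto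
  qed (simp add: zW)
  then show ?thesis
    using assms(3) zW by (cases "finite A") (auto simp: V.finsum_infinite)
qed

lemma submodule_zero_closed:
  assumes "module CC V" "submodule W CC V"
  shows "\<zero>\<^bsub>V\<^esub> \<in> W"
  using submodule_finsum_closed[OF assms, of "{}" undefined] module.axioms(2)[OF assms(1)]
  by (metis abelian_group_def abelian_monoid.finsum_empty empty_iff)

lemma submodule_minus_closed:
  assumes "module CC V" "submodule W CC V" "x \<in> W" "y \<in> W"
  shows "x \<ominus>\<^bsub>V\<^esub> y \<in> W"
  using module.submoduleE[OF assms(1,2)] assms(3,4) by (simp add: a_minus_def)

lemma fin_supp_sum_eq_finsum:
  assumes "module CC V" "finite A" "\<And>i. i \<in> A \<Longrightarrow> f i \<in> carrier V" "\<And>i. i \<notin> A \<Longrightarrow> f i = \<zero>\<^bsub>V\<^esub>"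
  shows "fin_supp_sum V f = finsum V f A"
proof -
  interpret V: module CC V by fact
  show ?thesis
    unfolding fin_supp_sum_def
    by (rule V.add.finprod_mono_neutral_cong_left[folded finsum_def])
      (use assms in auto)
qed

section \<open>Quotients of vector spaces\<close>

locale quotient_space = module CC V for V :: "(complex, 'v) module" (structure) +
  fixes W :: "'v set"
  assumes submodule_W: "submodule W CC V"
begin

abbreviation proj :: "'v \<Rightarrow> 'v set" where "proj v \<equiv> W +> v"

abbreviation Q :: "(complex, 'v set) module" where "Q \<equiv> quot_module V W"

lemma abelian_subgroup_W: "abelian_subgroup W V"
  by (intro abelian_subgroupI3 additive_subgroup.intro submodule.axioms(1)[OF submodule_W]
      module.axioms(2)[OF module_axioms])

sublocale W: abelian_subgroup W V
  by (rule abelian_subgroup_W)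

lemma carrier_quot: "carrier Q = proj ` carrier V"
  by (auto simp: quot_module_def A_RCOSETS_def')

lemma quot_cases:
  assumes "A \<in> carrier Q"
  obtains a where "a \<in> carrier V" "A = proj a"
  using assms by (auto simp: carrier_quot)

lemma proj_closed: "v \<in> carrier V \<Longrightarrow> proj v \<in> carrier Q"
  by (simp add: carrier_quot)

lemma mem_projE:
  assumes "b \<in> proj a" "a \<in> carrier V"
  obtains w where "w \<in> W" "b = w \<oplus> a" "b \<in> carrier V"
  using assms W.a_elemrcos_carrier[OF assms(2,1)] by (auto simp: a_r_coset_def')

lemma add_Q: "\<lbrakk>a \<in> carrier V; b \<in> carrier V\<rbrakk> \<Longrightarrow> proj a \<oplus>\<^bsub>Q\<^esub> proj b = proj (a \<oplus> b)"
  by (simp add: quot_module_def W.a_rcos_sum)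

lemma zero_Q: "\<zero>\<^bsub>Q\<^esub> = proj \<zero>"
  by (simp add: quot_module_def W.a_rcos_const)

lemma proj_W: "w \<in> W \<Longrightarrow> proj w = proj \<zero>"
  by (simp add: W.a_rcos_const)

lemma smult_Q:
  assumes "a \<in> carrier V"
  shows "c \<odot>\<^bsub>Q\<^esub> proj a = proj (c \<odot> a)"
proof -
  have "proj (c \<odot> x) = proj (c \<odot> a)" if x: "x \<in> proj a" for x
  proof -
    obtain w where w: "w \<in> W" "x = w \<oplus> a" "x \<in> carrier V"
      using mem_projE[OF x assms] .
    have "proj (c \<odot> x) = proj (c \<odot> w) \<oplus>\<^bsub>Q\<^esub> proj (c \<odot> a)"
      using w assms by (simp add: smult_r_distr add_Q)
    also have "proj (c \<odot> w) = proj \<zero>"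
      using w(1) submoduleE(4)[OF submodule_W, of c w] by (intro proj_W) simp
    also have "proj \<zero> \<oplus>\<^bsub>Q\<^esub> proj (c \<odot> a) = proj (c \<odot> a)"
      using assms by (simp add: add_Q)
    finally show ?thesis .
  qed
  then have "(\<Union>x\<in>proj a. proj (c \<odot> x)) = proj (c \<odot> a)"
    using W.a_rcos_self[OF assms] by blast
  then show ?thesis
    by (simp add: quot_module_def)
qed

lemma module_Q: "module CC Q"
proof (rule moduleI)
  show "cring CC" by (rule R.is_cring)
  show "abelian_group Q"
  proof (rule abelian_groupI)
    fix x assume "x \<in> carrier Q"
    then obtain a where a: "a \<in> carrier V" "x = proj a" by (rule quot_cases)
    show "\<zero>\<^bsub>Q\<^esub> \<oplus>\<^bsub>Q\<^esub> x = x"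
      using a by (simp add: zero_Q add_Q)
    show "\<exists>y\<in>carrier Q. y \<oplus>\<^bsub>Q\<^esub> x = \<zero>\<^bsub>Q\<^esub>"
      using a by (intro bexI[of _ "proj (\<ominus> a)"]) (auto simp: proj_closed add_Q zero_Q l_neg)
    fix y assume "y \<in> carrier Q"
    then obtain b where b: "b \<in> carrier V" "y = proj b" by (rule quot_cases)
    show "x \<oplus>\<^bsub>Q\<^esub> y \<in> carrier Q"
      using a b by (simp add: add_Q proj_closed)
    show "x \<oplus>\<^bsub>Q\<^esub> y = y \<oplus>\<^bsub>Q\<^esub> x"
      using a b by (simp add: add_Q M.add.m_comm)
    fix z assume "z \<in> carrier Q"
    then obtain c where c: "c \<in> carrier V" "z = proj c" by (rule quot_cases)
    show "(x \<oplus>\<^bsub>Q\<^esub> y) \<oplus>\<^bsub>Q\<^esub> z = x \<oplus>\<^bsub>Q\<^esub> (y \<oplus>\<^bsub>Q\<^esub> z)"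
      using a b c by (simp add: add_Q M.add.m_assoc)
  next
    show "\<zero>\<^bsub>Q\<^esub> \<in> carrier Q"
      unfolding zero_Q by (intro proj_closed zero_closed)
  qed
next
  fix x assume "x \<in> carrier Q"
  then obtain a where a: "a \<in> carrier V" "x = proj a" by (rule quot_cases)
  show "\<one>\<^bsub>CC\<^esub> \<odot>\<^bsub>Q\<^esub> x = x"
    using a smult_one by (simp add: smult_Q)
  fix c e
  show "c \<odot>\<^bsub>Q\<^esub> x \<in> carrier Q"
    using a by (simp add: smult_Q proj_closed)
  show "(c \<oplus>\<^bsub>CC\<^esub> e) \<odot>\<^bsub>Q\<^esub> x = c \<odot>\<^bsub>Q\<^esub> x \<oplus>\<^bsub>Q\<^esub> e \<odot>\<^bsub>Q\<^esub> x"
    using a smult_l_distr[of c e a] by (simp add: smult_Q add_Q)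
  show "(c \<otimes>\<^bsub>CC\<^esub> e) \<odot>\<^bsub>Q\<^esub> x = c \<odot>\<^bsub>Q\<^esub> (e \<odot>\<^bsub>Q\<^esub> x)"
    using a smult_assoc1[of c e a] by (simp add: smult_Q)
  fix y assume "y \<in> carrier Q"
  then obtain b where b: "b \<in> carrier V" "y = proj b" by (rule quot_cases)
  show "c \<odot>\<^bsub>Q\<^esub> (x \<oplus>\<^bsub>Q\<^esub> y) = c \<odot>\<^bsub>Q\<^esub> x \<oplus>\<^bsub>Q\<^esub> c \<odot>\<^bsub>Q\<^esub> y"
    using a b by (simp add: smult_Q add_Q smult_r_distr)
qed

sublocale Q: module CC Q
  by (rule module_Q)

lemma neg_Q: "a \<in> carrier V \<Longrightarrow> \<ominus>\<^bsub>Q\<^esub> proj a = proj (\<ominus> a)"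
  by (rule Q.minus_equality) (auto simp: proj_closed add_Q zero_Q l_neg)

lemma minus_Q: "\<lbrakk>a \<in> carrier V; b \<in> carrier V\<rbrakk> \<Longrightarrow> proj a \<ominus>\<^bsub>Q\<^esub> proj b = proj (a \<ominus> b)"
  by (simp add: a_minus_def neg_Q add_Q)

lemma finsum_Q:
  assumes "finite A" "\<And>i. i \<in> A \<Longrightarrow> f i \<in> carrier V"
  shows "finsum Q (\<lambda>i. proj (f i)) A = proj (finsum V f A)"
  using assms
proof (induction A rule: finite_induct)
  case empty
  show ?case by (simp add: zero_Q)
next
  case (insert x F)
  have "finsum Q (\<lambda>i. proj (f i)) (insert x F) = proj (f x) \<oplus>\<^bsub>Q\<^esub> finsum Q (\<lambda>i. proj (f i)) F"
    using insert by (intro Q.finsum_insert) (auto intro: proj_closed)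
  also have "\<dots> = proj (f x \<oplus> finsum V f F)"
    using insert by (simp add: add_Q)
  also have "f x \<oplus> finsum V f F = finsum V f (insert x F)"
    using insert by (intro finsum_insert[symmetric]) auto
  finally show ?case .
qed

lemma fin_supp_sum_Q:
  assumes "\<And>i. f i \<in> carrier V" "\<And>i. i > n \<Longrightarrow> f i = \<zero>"
  shows "fin_supp_sum Q (\<lambda>i. proj (f i)) = proj (fin_supp_sum V f)"
proof -
  have "fin_supp_sum V f = finsum V f {..n}"
    using assms by (intro fin_supp_sum_eq_finsum module_axioms) (auto simp: not_le)
  moreover have "fin_supp_sum Q (\<lambda>i. proj (f i)) = finsum Q (\<lambda>i. proj (f i)) {..n}"
    using assms by (intro fin_supp_sum_eq_finsum module_Q) (auto simp: proj_closed zero_Q not_le)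
  ultimately show ?thesis
    using assms by (simp add: finsum_Q)
qed

end

section \<open>Consequences of the Borcherds identity\<close>

context vertex_algebra
begin

lemma Y_zero_left: "b \<in> carrier V \<Longrightarrow> Y \<zero> n b = \<zero>"
  using Y_smult_left[of \<zero> b 0] Y_closed[of \<zero> b] smult_l_null[simplified] by simp

lemma Y_zero_right: "a \<in> carrier V \<Longrightarrow> Y a n \<zero> = \<zero>"
  using Y_smult_right[of a \<zero> n 0] Y_closed[of a \<zero>] smult_l_null[simplified] by simp

lemma truncation_nat:
  assumes "a \<in> carrier V" "b \<in> carrier V"
  obtains N :: nat where "\<And>i. i > N \<Longrightarrow> Y a (k + int i) b = \<zero>"
proof -
  obtain M where M: "\<And>n. n \<ge> M \<Longrightarrow> Y a n b = \<zero>"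
    using truncation[OF assms] by blast
  show ?thesis by (rule that[of "nat (M - k)"]) (auto intro!: M)
qed

text \<open>\<open>borcherds_lhs\<close> and \<open>borcherds_rhs\<close> are the families whose sums
  are the two sides of the Borcherds identity. Both are finitely supported by truncation,
  which is what makes the identity pass to quotients.\<close>

definition borcherds_lhs :: "'v \<Rightarrow> 'v \<Rightarrow> 'v \<Rightarrow> int \<Rightarrow> int \<Rightarrow> int \<Rightarrow> nat \<Rightarrow> 'v" where
  "borcherds_lhs a b c l m n i = (of_int m gchoose i) \<odot> Y (Y a (l + int i) b) (m + n - int i) c"

definition borcherds_rhs :: "'v \<Rightarrow> 'v \<Rightarrow> 'v \<Rightarrow> int \<Rightarrow> int \<Rightarrow> int \<Rightarrow> nat \<Rightarrow> 'v" where
  "borcherds_rhs a b c l m n i = ((- 1) ^ i * (of_int l gchoose i)) \<odot>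
            (Y a (l + m - int i) (Y b (n + int i) c) \<ominus>
             ((- 1) powi l) \<odot> Y b (l + n - int i) (Y a (m + int i) c))"

lemma borcherds_sides_eq: "\<lbrakk>a \<in> carrier V; b \<in> carrier V; c \<in> carrier V\<rbrakk> \<Longrightarrow>
   fin_supp_sum V (borcherds_lhs a b c l m n) = fin_supp_sum V (borcherds_rhs a b c l m n)"
  unfolding borcherds_lhs_def[abs_def] borcherds_rhs_def[abs_def] by (rule borcherds)

lemma borcherds_lhs_closed:
  "\<lbrakk>a \<in> carrier V; b \<in> carrier V; c \<in> carrier V\<rbrakk> \<Longrightarrow> borcherds_lhs a b c l m n i \<in> carrier V"
  by (simp add: borcherds_lhs_def Y_closed)

lemma borcherds_rhs_closed:
  "\<lbrakk>a \<in> carrier V; b \<in> carrier V; c \<in> carrier V\<rbrakk> \<Longrightarrow> borcherds_rhs a b c l m n i \<in> carrier V"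
  by (simp add: borcherds_rhs_def Y_closed)

lemma borcherds_lhs_finite:
  assumes "a \<in> carrier V" "b \<in> carrier V" "c \<in> carrier V"
  obtains N where "\<And>i. i > N \<Longrightarrow> borcherds_lhs a b c l m n i = \<zero>"
proof -
  obtain N where "\<And>i. i > N \<Longrightarrow> Y a (l + int i) b = \<zero>"
    using truncation_nat assms(1,2) by metis
  then show ?thesis
    using assms smult_r_null by (intro that[of N]) (simp add: borcherds_lhs_def Y_zero_left)
qed

lemma borcherds_rhs_finite:
  assumes "a \<in> carrier V" "b \<in> carrier V" "c \<in> carrier V"
  obtains N where "\<And>i. i > N \<Longrightarrow> borcherds_rhs a b c l m n i = \<zero>"
proof -
  obtain N where N: "\<And>i. i > N \<Longrightarrow> Y b (n + int i) c = \<zero>"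
    using truncation_nat assms(2,3) by metis
  obtain M where M: "\<And>i. i > M \<Longrightarrow> Y a (m + int i) c = \<zero>"
    using truncation_nat assms(1,3) by metis
  show ?thesis
  proof (rule that[of "max N M"])
    fix i assume i: "i > max N M"
    have null: "z \<odot> \<zero> = \<zero>" for z
      using smult_r_null[of z] by simp
    have "\<zero> \<ominus> \<zero> = \<zero>"
      by (simp add: a_minus_def r_neg)
    then show "borcherds_rhs a b c l m n i = \<zero>"
      unfolding borcherds_rhs_def using i assms by (simp only: N M Y_zero_right null max_less_iff_conj)
  qed
qed

text \<open>For \<open>m = 0\<close> the left side of the Borcherds identity has \<open>Y (Y a l b) n
  c\<close> as its only nonzero term, and each term on the right is a combination of iterated
  products of \<open>a\<close> and \<open>b\<close> applied to \<open>c\<close>.\<close>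

lemma iterate_mem_submodule:
  assumes W: "submodule W CC V"
    and abc: "a \<in> carrier V" "b \<in> carrier V" "c \<in> carrier V"
    and ab: "\<And>k k'. Y a k (Y b k' c) \<in> W" and ba: "\<And>k k'. Y b k (Y a k' c) \<in> W"
  shows "Y (Y a l b) n c \<in> W"
proof -
  have "fin_supp_sum V (borcherds_lhs a b c l 0 n) = finsum V (borcherds_lhs a b c l 0 n) {0}"
  proof (rule fin_supp_sum_eq_finsum[OF module_axioms])
    fix i :: nat assume "i \<notin> {0}"
    then have "((0 :: complex) gchoose i) = 0" by (cases i) simp_all
    then have "borcherds_lhs a b c l 0 n i = 0 \<odot> Y (Y a (l + int i) b) (0 + n - int i) c"
      unfolding borcherds_lhs_def by simp
    then show "borcherds_lhs a b c l 0 n i = \<zero>"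
      using smult_l_null Y_closed abc by simp
  qed (use abc in \<open>simp_all add: borcherds_lhs_closed\<close>)
  also have "\<dots> = borcherds_lhs a b c l 0 n 0"
    using abc by (simp add: borcherds_lhs_closed)
  also have "\<dots> = Y (Y a l b) n c"
    using smult_one abc Y_closed by (simp add: borcherds_lhs_def)
  finally have "Y (Y a l b) n c = fin_supp_sum V (borcherds_rhs a b c l 0 n)"
    using borcherds_sides_eq[OF abc, of l 0 n] by simp
  also have "\<dots> \<in> W"
    unfolding fin_supp_sum_def borcherds_rhs_def
    by (intro submodule_finsum_closed submodule_minus_closed module_axioms W
        submodule.smult_closed[OF W] ab ba) simp_all
  finally show ?thesis .
qed

text \<open>The case \<open>l = 0\<close> of the Borcherds identity is the commutator formula: its left
  side involves only the products \<open>Y a i b\<close> with \<open>i \<ge> 0\<close>.\<close>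

lemma modes_commute:
  assumes abc: "a \<in> carrier V" "b \<in> carrier V" "c \<in> carrier V"
    and zero: "\<And>i. i \<ge> 0 \<Longrightarrow> Y a i b = \<zero>"
  shows "Y a m (Y b n c) = Y b n (Y a m c)"
proof -
  have "borcherds_lhs a b c 0 m n i = \<zero>" for i
    using zero[of "int i"] smult_r_null abc by (simp add: borcherds_lhs_def Y_zero_left)
  then have "fin_supp_sum V (borcherds_lhs a b c 0 m n) = \<zero>"
    by (simp add: fin_supp_sum_def)
  moreover have "fin_supp_sum V (borcherds_rhs a b c 0 m n) = finsum V (borcherds_rhs a b c 0 m n) {0}"
  proof (rule fin_supp_sum_eq_finsum[OF module_axioms])
    fix i :: nat assume "i \<notin> {0}"
    then have "((0 :: complex) gchoose i) = 0" by (cases i) simp_all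
    then have "borcherds_rhs a b c 0 m n i = 0 \<odot>
       (Y a (0 + m - int i) (Y b (n + int i) c) \<ominus> ((- 1) powi 0) \<odot> Y b (0 + n - int i) (Y a (m + int i) c))"
      unfolding borcherds_rhs_def by simp
    then show "borcherds_rhs a b c 0 m n i = \<zero>"
      using smult_l_null Y_closed abc by simp
  qed (use abc in \<open>simp_all add: borcherds_rhs_closed\<close>)
  moreover have "finsum V (borcherds_rhs a b c 0 m n) {0} = borcherds_rhs a b c 0 m n 0"
    using abc by (simp add: borcherds_rhs_closed)
  moreover have "borcherds_rhs a b c 0 m n 0 = Y a m (Y b n c) \<ominus> Y b n (Y a m c)"
    using smult_one abc Y_closed by (simp add: borcherds_rhs_def)
  ultimately have "Y a m (Y b n c) \<ominus> Y b n (Y a m c) = \<zero>"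
    using borcherds_sides_eq[OF abc, of 0 m n] by simp
  moreover have "Y a m (Y b n c) \<ominus> Y b n (Y a m c) \<oplus> Y b n (Y a m c) = Y a m (Y b n c)"
    using abc Y_closed by (simp add: a_minus_def M.add.m_assoc l_neg)
  ultimately show ?thesis
    using abc Y_closed by simp
qed

end

section \<open>Quotients of vertex algebras by ideals\<close>

locale vertex_algebra_ideal = vertex_algebra V Y vac
  for V :: "(complex, 'v) module" (structure) and Y vac +
  fixes W :: "'v set"
  assumes ideal: "va_ideal V Y W"
begin

sublocale quotient_space V W
  by (intro quotient_space.intro module_axioms quotient_space_axioms.intro)
    (use ideal in \<open>unfold va_ideal_def, blast\<close>)

abbreviation YQ :: "'v set \<Rightarrow> int \<Rightarrow> 'v set \<Rightarrow> 'v set" where "YQ \<equiv> quot_Y V Y W"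

text \<open>Changing the representative of the first factor changes the product by an element of
  \<open>W\<close> since \<open>Y w n b \<in> W\<close>, and changing that of the second one
  does so since \<open>Y a n w \<in> W\<close>; hence both halves of the ideal condition are
  needed.\<close>

lemma quot_Y_proj:
  assumes "a \<in> carrier V" "b \<in> carrier V"
  shows "YQ (proj a) n (proj b) = proj (Y a n b)"
proof -
  have "proj (Y a' n b') = proj (Y a n b)" if a': "a' \<in> proj a" and b': "b' \<in> proj b" for a' b'
  proof -
    obtain w where w: "w \<in> W" "a' = w \<oplus> a" "a' \<in> carrier V"
      using mem_projE[OF a' assms(1)] .
    obtain u where u: "u \<in> W" "b' = u \<oplus> b" "b' \<in> carrier V"
      using mem_projE[OF b' assms(2)] .
    have "proj (Y a' n b') = proj (Y w n b') \<oplus>\<^bsub>Q\<^esub> proj (Y a n b')"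
      using w u(3) assms by (simp add: Y_add_left add_Q Y_closed)
    also have "proj (Y a n b') = proj (Y a n u) \<oplus>\<^bsub>Q\<^esub> proj (Y a n b)"
      using u assms by (simp add: Y_add_right add_Q Y_closed)
    also have "proj (Y w n b') = proj \<zero>"
      using w(1) u(3) ideal by (intro proj_W) (auto simp: va_ideal_def)
    also have "proj (Y a n u) = proj \<zero>"
      using u(1) assms ideal by (intro proj_W) (auto simp: va_ideal_def)
    finally show ?thesis
      using assms by (simp add: add_Q Y_closed)
  qed
  then show ?thesis
    using W.a_rcos_self[OF assms(1)] W.a_rcos_self[OF assms(2)] unfolding quot_Y_def by blast
qed

theorem quotient_vertex_algebra: "vertex_algebra Q YQ (proj vac)"
proof (intro vertex_algebra.intro vertex_algebra_axioms.intro module_Q)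
  fix A B C l m n
  assume "A \<in> carrier Q" "B \<in> carrier Q" "C \<in> carrier Q"
  then obtain a b c where abc: "a \<in> carrier V" "A = proj a" "b \<in> carrier V" "B = proj b"
    "c \<in> carrier V" "C = proj c"
    unfolding carrier_quot by blast
  obtain N where N: "\<And>i. i > N \<Longrightarrow> borcherds_lhs a b c l m n i = \<zero>"
    using borcherds_lhs_finite abc by blast
  obtain M where M: "\<And>i. i > M \<Longrightarrow> borcherds_rhs a b c l m n i = \<zero>"
    using borcherds_rhs_finite abc by blast
  have "fin_supp_sum Q (\<lambda>i. (of_int m gchoose i) \<odot>\<^bsub>Q\<^esub> YQ (YQ A (l + int i) B) (m + n - int i) C) =
        fin_supp_sum Q (\<lambda>i. proj (borcherds_lhs a b c l m n i))"
    using abc by (simp add: borcherds_lhs_def quot_Y_proj Y_closed smult_Q)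
  also have "\<dots> = proj (fin_supp_sum V (borcherds_lhs a b c l m n))"
    using abc N by (intro fin_supp_sum_Q borcherds_lhs_closed)
  also have "\<dots> = proj (fin_supp_sum V (borcherds_rhs a b c l m n))"
    using abc by (simp add: borcherds_sides_eq)
  also have "\<dots> = fin_supp_sum Q (\<lambda>i. proj (borcherds_rhs a b c l m n i))"
    using abc M by (intro fin_supp_sum_Q[symmetric] borcherds_rhs_closed)
  also have "\<dots> = fin_supp_sum Q (\<lambda>i. ((- 1) ^ i * (of_int l gchoose i)) \<odot>\<^bsub>Q\<^esub>
            (YQ A (l + m - int i) (YQ B (n + int i) C) \<ominus>\<^bsub>Q\<^esub>
             ((- 1) powi l) \<odot>\<^bsub>Q\<^esub> YQ B (l + n - int i) (YQ A (m + int i) C)))"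
    using abc by (simp add: borcherds_rhs_def quot_Y_proj Y_closed smult_Q minus_Q)
  finally show "fin_supp_sum Q (\<lambda>i. (of_int m gchoose i) \<odot>\<^bsub>Q\<^esub> YQ (YQ A (l + int i) B) (m + n - int i) C) =
       fin_supp_sum Q (\<lambda>i. ((- 1) ^ i * (of_int l gchoose i)) \<odot>\<^bsub>Q\<^esub>
            (YQ A (l + m - int i) (YQ B (n + int i) C) \<ominus>\<^bsub>Q\<^esub>
             ((- 1) powi l) \<odot>\<^bsub>Q\<^esub> YQ B (l + n - int i) (YQ A (m + int i) C)))" .
next
  fix A B assume "A \<in> carrier Q" "B \<in> carrier Q"
  then obtain a b where ab: "a \<in> carrier V" "A = proj a" "b \<in> carrier V" "B = proj b"
    unfolding carrier_quot by blast
  obtain N where "\<And>n. n \<ge> N \<Longrightarrow> Y a n b = \<zero>"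
    using truncation ab by blast
  then show "\<exists>N. \<forall>n\<ge>N. YQ A n B = \<zero>\<^bsub>Q\<^esub>"
    using ab by (intro exI[of _ N]) (simp add: quot_Y_proj zero_Q)
  fix n s
  show "YQ A n B \<in> carrier Q"
    using ab by (simp add: quot_Y_proj proj_closed Y_closed)
  show "YQ (s \<odot>\<^bsub>Q\<^esub> A) n B = s \<odot>\<^bsub>Q\<^esub> YQ A n B" "YQ A n (s \<odot>\<^bsub>Q\<^esub> B) = s \<odot>\<^bsub>Q\<^esub> YQ A n B"
    using ab by (simp_all add: smult_Q quot_Y_proj Y_closed Y_smult_left Y_smult_right)
  fix C assume "C \<in> carrier Q"
  then obtain c where c: "c \<in> carrier V" "C = proj c" by (rule quot_cases)
  show "YQ (A \<oplus>\<^bsub>Q\<^esub> B) n C = YQ A n C \<oplus>\<^bsub>Q\<^esub> YQ B n C"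
    "YQ A n (B \<oplus>\<^bsub>Q\<^esub> C) = YQ A n B \<oplus>\<^bsub>Q\<^esub> YQ A n C"
    using ab c by (simp_all add: add_Q quot_Y_proj Y_closed Y_add_left Y_add_right)
next
  fix A and n :: int assume "A \<in> carrier Q"
  then obtain a where a: "a \<in> carrier V" "A = proj a" by (rule quot_cases)
  show "YQ (proj vac) n A = (if n = - 1 then A else \<zero>\<^bsub>Q\<^esub>)"
    using a by (simp add: quot_Y_proj vac_closed vacuum zero_Q)
  show "YQ A (- 1) (proj vac) = A"
    using a by (simp add: quot_Y_proj vac_closed creation)
  show "YQ A n (proj vac) = \<zero>\<^bsub>Q\<^esub>" if "n \<ge> 0"
    using a that by (simp add: quot_Y_proj vac_closed creation_nonneg zero_Q)
qed (simp add: proj_closed vac_closed)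

end

section \<open>The free algebra on a set\<close>

lemma carrier_free_algebra:
  "p \<in> carrier (free_algebra S) \<longleftrightarrow> finite {w. p w \<noteq> 0} \<and> (\<forall>w. p w \<noteq> 0 \<longrightarrow> set w \<subseteq> S)"
  by (auto simp: free_algebra_def)

lemma add_free_algebra [simp]: "p \<oplus>\<^bsub>free_algebra S\<^esub> q = (\<lambda>w. p w + q w)"
  and zero_free_algebra [simp]: "\<zero>\<^bsub>free_algebra S\<^esub> = (\<lambda>w. 0)"
  and one_free_algebra [simp]: "\<one>\<^bsub>free_algebra S\<^esub> = fmonom 1 []"
  and mult_free_algebra:
    "p \<otimes>\<^bsub>free_algebra S\<^esub> q = (\<lambda>w. \<Sum>k\<le>length w. p (take k w) * q (drop k w))"
  by (auto simp: free_algebra_def fmonom_def)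

lemma fmonom_closed [simp]: "set v \<subseteq> S \<Longrightarrow> fmonom c v \<in> carrier (free_algebra S)"
  by (auto simp: carrier_free_algebra fmonom_def split: if_splits)

lemma free_algebra_add_closed:
  assumes "p \<in> carrier (free_algebra S)" "q \<in> carrier (free_algebra S)"
  shows "(\<lambda>w. p w + q w) \<in> carrier (free_algebra S)"
proof -
  have "{w. p w + q w \<noteq> 0} \<subseteq> {w. p w \<noteq> 0} \<union> {w. q w \<noteq> 0}" by auto
  moreover have "finite ({w. p w \<noteq> 0} \<union> {w. q w \<noteq> 0})"
    using assms by (simp add: carrier_free_algebra)
  ultimately have "finite {w. p w + q w \<noteq> 0}"
    by (rule finite_subset)
  moreover have "set w \<subseteq> S" if "p w + q w \<noteq> 0" for w
    using assms that unfolding carrier_free_algebra by (cases "p w = 0") auto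
  ultimately show ?thesis by (simp add: carrier_free_algebra)
qed

lemma free_algebra_uminus_closed:
  "p \<in> carrier (free_algebra S) \<Longrightarrow> (\<lambda>w. - p w) \<in> carrier (free_algebra S)"
  by (simp add: carrier_free_algebra)

lemma free_algebra_mult_closed:
  assumes "p \<in> carrier (free_algebra S)" "q \<in> carrier (free_algebra S)"
  shows "p \<otimes>\<^bsub>free_algebra S\<^esub> q \<in> carrier (free_algebra S)"
proof -
  have split: "\<exists>k. p (take k w) \<noteq> 0 \<and> q (drop k w) \<noteq> 0" if "(p \<otimes>\<^bsub>free_algebra S\<^esub> q) w \<noteq> 0" for w
  proof (rule ccontr)
    assume "\<not> ?thesis"
    then have "(p \<otimes>\<^bsub>free_algebra S\<^esub> q) w = 0"
      unfolding mult_free_algebra by (intro sum.neutral) auto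
    then show False using that by contradiction
  qed
  have "{w. (p \<otimes>\<^bsub>free_algebra S\<^esub> q) w \<noteq> 0} \<subseteq> (\<lambda>(u, v). u @ v) ` ({w. p w \<noteq> 0} \<times> {w. q w \<noteq> 0})"
  proof
    fix w assume "w \<in> {w. (p \<otimes>\<^bsub>free_algebra S\<^esub> q) w \<noteq> 0}"
    then obtain k where "p (take k w) \<noteq> 0" "q (drop k w) \<noteq> 0" using split by blast
    then show "w \<in> (\<lambda>(u, v). u @ v) ` ({w. p w \<noteq> 0} \<times> {w. q w \<noteq> 0})"
      by (intro image_eqI[of _ _ "(take k w, drop k w)"]) auto
  qed
  moreover have "finite ((\<lambda>(u, v). u @ v) ` ({w. p w \<noteq> 0} \<times> {w. q w \<noteq> 0}))"
    using assms by (simp add: carrier_free_algebra)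
  moreover have "set w \<subseteq> S" if nz: "(p \<otimes>\<^bsub>free_algebra S\<^esub> q) w \<noteq> 0" for w
  proof -
    obtain k where "p (take k w) \<noteq> 0" "q (drop k w) \<noteq> 0" using split[OF nz] by blast
    then have "set (take k w) \<union> set (drop k w) \<subseteq> S"
      using assms by (simp add: carrier_free_algebra)
    then show ?thesis using set_append[of "take k w" "drop k w"] by simp
  qed
  ultimately show ?thesis
    unfolding carrier_free_algebra by (intro conjI allI impI, elim finite_subset)
qed

text \<open>Both products sum over all ways to cut a word into three pieces: on the left by the
  positions \<open>j \<le> k\<close> of the cuts, on the right by the position of the first
  cut and the length \<open>k - j\<close> of the middle piece.\<close>

lemma free_algebra_assoc:
  "(p \<otimes>\<^bsub>free_algebra S\<^esub> q) \<otimes>\<^bsub>free_algebra S\<^esub> r = p \<otimes>\<^bsub>free_algebra S\<^esub> (q \<otimes>\<^bsub>free_algebra S\<^esub> r)"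
proof
  fix w :: "'a list"
  let ?n = "length w"
  have "((p \<otimes>\<^bsub>free_algebra S\<^esub> q) \<otimes>\<^bsub>free_algebra S\<^esub> r) w =
        (\<Sum>k\<le>?n. \<Sum>j\<le>k. p (take j w) * q (take (k - j) (drop j w)) * r (drop k w))"
    by (auto simp: mult_free_algebra sum_distrib_right drop_take min.absorb2 intro!: sum.cong)
  also have "\<dots> = (\<Sum>(k, j)\<in>(SIGMA k:{..?n}. {..k}). p (take j w) * q (take (k - j) (drop j w)) * r (drop k w))"
    by (rule sum.Sigma) auto
  also have "\<dots> = (\<Sum>(j, i)\<in>(SIGMA j:{..?n}. {..?n - j}).
                      p (take j w) * (q (take i (drop j w)) * r (drop i (drop j w))))"
    by (rule sum.reindex_bij_witness[of _ "\<lambda>(j, i). (i + j, j)" "\<lambda>(k, j). (j, k - j)"]) auto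
  also have "\<dots> = (\<Sum>j\<le>?n. \<Sum>i\<le>?n - j. p (take j w) * (q (take i (drop j w)) * r (drop i (drop j w))))"
    by (rule sum.Sigma[symmetric]) auto
  also have "\<dots> = (p \<otimes>\<^bsub>free_algebra S\<^esub> (q \<otimes>\<^bsub>free_algebra S\<^esub> r)) w"
    by (simp add: mult_free_algebra sum_distrib_left)
  finally show "((p \<otimes>\<^bsub>free_algebra S\<^esub> q) \<otimes>\<^bsub>free_algebra S\<^esub> r) w =
    (p \<otimes>\<^bsub>free_algebra S\<^esub> (q \<otimes>\<^bsub>free_algebra S\<^esub> r)) w" .
qed

lemma fmonom_mult: "fmonom c u \<otimes>\<^bsub>free_algebra S\<^esub> q =
    (\<lambda>w. if take (length u) w = u then c * q (drop (length u) w) else 0)"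
proof
  fix w :: "'a list"
  have "(fmonom c u \<otimes>\<^bsub>free_algebra S\<^esub> q) w =
        (\<Sum>k\<le>length w. if k = length u then (if take (length u) w = u then c * q (drop (length u) w) else 0) else 0)"
    unfolding mult_free_algebra by (rule sum.cong) (auto simp: fmonom_def min_def split: if_splits)
  also have "\<dots> = (if take (length u) w = u then c * q (drop (length u) w) else 0)"
    by auto
  finally show "(fmonom c u \<otimes>\<^bsub>free_algebra S\<^esub> q) w = \<dots>" .
qed

lemma fmonom_mult_fmonom [simp]:
  "fmonom c u \<otimes>\<^bsub>free_algebra S\<^esub> fmonom e v = fmonom (c * e) (u @ v)"
proof
  fix w
  have "w = u @ v \<longleftrightarrow> take (length u) w = u \<and> drop (length u) w = v"
    by (metis append_eq_conv_conj)
  then show "(fmonom c u \<otimes>\<^bsub>free_algebra S\<^esub> fmonom e v) w = fmonom (c * e) (u @ v) w"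
    unfolding fmonom_mult by (simp add: fmonom_def)
qed

lemma mult_one_free_algebra: "p \<otimes>\<^bsub>free_algebra S\<^esub> fmonom 1 [] = p"
proof
  fix w :: "'a list"
  have "(p \<otimes>\<^bsub>free_algebra S\<^esub> fmonom 1 []) w = (\<Sum>k\<le>length w. if k = length w then p w else 0)"
    unfolding mult_free_algebra by (rule sum.cong) (auto simp: fmonom_def)
  then show "(p \<otimes>\<^bsub>free_algebra S\<^esub> fmonom 1 []) w = p w" by simp
qed

lemma free_algebra_ring: "ring (free_algebra S)"
proof (rule ringI)
  show "abelian_group (free_algebra S)"
    by (rule abelian_groupI)
      (auto simp: free_algebra_add_closed fun_eq_iff carrier_free_algebra[of "\<lambda>w. 0"]
        intro!: bexI[OF _ free_algebra_uminus_closed])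
  show "monoid (free_algebra S)"
    by (rule monoidI)
      (simp_all add: free_algebra_mult_closed free_algebra_assoc mult_one_free_algebra, simp add: fmonom_mult)
qed (simp_all add: mult_free_algebra distrib_left distrib_right sum.distrib)

lemma a_inv_free_algebra:
  assumes "p \<in> carrier (free_algebra S)"
  shows "\<ominus>\<^bsub>free_algebra S\<^esub> p = (\<lambda>w. - p w)"
proof -
  interpret ring "free_algebra S" by (rule free_algebra_ring)
  show ?thesis
    by (rule minus_equality) (auto simp: assms free_algebra_uminus_closed)
qed

lemma minus_free_algebra:
  "q \<in> carrier (free_algebra S) \<Longrightarrow> p \<ominus>\<^bsub>free_algebra S\<^esub> q = (\<lambda>w. p w - q w)"
  by (simp add: a_minus_def a_inv_free_algebra)

lemma free_algebra_induct [consumes 1, case_names zero add]: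
  assumes "p \<in> carrier (free_algebra S)"
    and zero: "P (\<lambda>w. 0)"
    and add: "\<And>p c v. p \<in> carrier (free_algebra S) \<Longrightarrow> set v \<subseteq> S \<Longrightarrow> P p \<Longrightarrow>
                P (\<lambda>w. fmonom c v w + p w)"
  shows "P p"
proof -
  have "finite A \<Longrightarrow> p \<in> carrier (free_algebra S) \<Longrightarrow> {w. p w \<noteq> 0} \<subseteq> A \<Longrightarrow> P p" for A
  proof (induction A arbitrary: p rule: finite_induct)
    case empty
    then have "p = (\<lambda>w. 0)" by auto
    then show ?case using zero by simp
  next
    case (insert v A)
    show ?case
    proof (cases "p v = 0")
      case True
      then show ?thesis using insert by auto
    next
      case False
      let ?q = "p(v := 0)"
      have sub: "{w. ?q w \<noteq> 0} \<subseteq> {w. p w \<noteq> 0}" by auto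
      then have q: "?q \<in> carrier (free_algebra S)"
        using insert.prems(1) unfolding carrier_free_algebra
        by (intro conjI finite_subset[OF sub]) auto
      moreover have "P ?q"
        by (rule insert.IH[OF q]) (use insert.prems(2) in auto)
      moreover have "set v \<subseteq> S"
        using False insert.prems(1) by (simp add: carrier_free_algebra)
      ultimately have "P (\<lambda>w. fmonom (p v) v w + ?q w)" by (intro add)
      also have "(\<lambda>w. fmonom (p v) v w + ?q w) = p" by (auto simp: fmonom_def)
      finally show ?thesis .
    qed
  qed
  then show ?thesis using assms(1) by (auto simp: carrier_free_algebra)
qed

section \<open>Universal enveloping algebras\<close>

lemma quotient_coset_eqI:
  assumes "ideal I R" "x \<in> carrier R" "y \<in> carrier R" "x \<ominus>\<^bsub>R\<^esub> y \<in> I"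
  shows "I +>\<^bsub>R\<^esub> x = I +>\<^bsub>R\<^esub> y"
proof -
  interpret ideal I R by fact
  have "x \<in> I +>\<^bsub>R\<^esub> y"
    using assms(2-4) by (intro a_rcos_module_rev) (simp_all add: a_minus_def)
  then show ?thesis
    using a_repr_independence'[OF _ assms(3)] by simp
qed

text \<open>The operations of \<open>free_algebra S\<close> do not depend on \<open>S\<close>, so ideals
  can be restricted to a smaller alphabet. This yields the map \<open>U(H) \<rightarrow>
  U(L)\<close> for a subalgebra \<open>H\<close>.\<close>

lemma ideal_restrict_free_algebra:
  assumes J: "ideal J (free_algebra S)" and "T \<subseteq> S"
  shows "ideal (J \<inter> carrier (free_algebra T)) (free_algebra T)"
proof -
  interpret J: ideal J "free_algebra S" by fact
  interpret T: ring "free_algebra T" by (rule free_algebra_ring)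
  have TS: "p \<in> carrier (free_algebra S)" if "p \<in> carrier (free_algebra T)" for p
    using that \<open>T \<subseteq> S\<close> by (auto simp: carrier_free_algebra)
  show ?thesis
  proof (rule idealI)
    show "ring (free_algebra T)" by (rule free_algebra_ring)
    show "subgroup (J \<inter> carrier (free_algebra T)) (add_monoid (free_algebra T))"
    proof (rule group.subgroupI)
      show "group (add_monoid (free_algebra T))" by (rule T.add.is_group)
      show "J \<inter> carrier (free_algebra T) \<noteq> {}"
        using additive_subgroup.zero_closed[OF J.is_additive_subgroup] T.zero_closed
        by (intro ex_in_conv[THEN iffD1] exI[of _ "\<lambda>w. 0"]) simp
    next
      fix p assume p: "p \<in> J \<inter> carrier (free_algebra T)"
      then have "\<ominus>\<^bsub>free_algebra S\<^esub> p \<in> J" "\<ominus>\<^bsub>free_algebra T\<^esub> p \<in> carrier (free_algebra T)"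
        using additive_subgroup.a_inv_closed[OF J.is_additive_subgroup] T.a_inv_closed by blast+
      then have "\<ominus>\<^bsub>free_algebra T\<^esub> p \<in> J \<inter> carrier (free_algebra T)"
        using p TS by (simp add: a_inv_free_algebra)
      then show "inv\<^bsub>add_monoid (free_algebra T)\<^esub> p \<in> J \<inter> carrier (free_algebra T)"
        by (simp add: a_inv_def)
    next
      fix p q assume "p \<in> J \<inter> carrier (free_algebra T)" "q \<in> J \<inter> carrier (free_algebra T)"
      then show "p \<otimes>\<^bsub>add_monoid (free_algebra T)\<^esub> q \<in> J \<inter> carrier (free_algebra T)"
        using additive_subgroup.a_closed[OF J.is_additive_subgroup, of p q] free_algebra_add_closed[of p T q] by simp
    qed simp
  next
    fix p q assume p: "p \<in> J \<inter> carrier (free_algebra T)" and q: "q \<in> carrier (free_algebra T)"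
    show "q \<otimes>\<^bsub>free_algebra T\<^esub> p \<in> J \<inter> carrier (free_algebra T)"
      using J.I_l_closed[of p q] p q TS[of q] free_algebra_mult_closed[of q T p]
      by (simp add: mult_free_algebra)
    show "p \<otimes>\<^bsub>free_algebra T\<^esub> q \<in> J \<inter> carrier (free_algebra T)"
      using J.I_r_closed[of p q] p q TS[of q] free_algebra_mult_closed[of p T q]
      by (simp add: mult_free_algebra)
  qed
qed

text \<open>The kernel of the counit. It contains all relations of an enveloping algebra
  (\<open>uea_ideal_augmentation\<close>), so that the constant coefficient depends only on
  the class of a representative.\<close>

lemma augmentation_ideal:
  "ideal {p \<in> carrier (free_algebra S). p [] = 0} (free_algebra S)" (is "ideal ?J ?F")
proof (rule idealI)
  interpret ring ?F by (rule free_algebra_ring)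
  show "ring ?F" by (rule free_algebra_ring)
  show "subgroup ?J (add_monoid ?F)"
  proof (rule group.subgroupI)
    show "group (add_monoid ?F)" by (rule add.is_group)
    show "?J \<noteq> {}" using zero_closed by auto
    fix p assume p: "p \<in> ?J"
    then have "\<ominus>\<^bsub>?F\<^esub> p \<in> ?J"
      by (simp add: a_inv_free_algebra free_algebra_uminus_closed)
    then show "inv\<^bsub>add_monoid ?F\<^esub> p \<in> ?J" by (simp add: a_inv_def)
    fix q assume "q \<in> ?J"
    then show "p \<otimes>\<^bsub>add_monoid ?F\<^esub> q \<in> ?J"
      using p by (simp add: free_algebra_add_closed)
  qed auto
qed (simp_all add: free_algebra_mult_closed, simp_all add: mult_free_algebra)

text \<open>The quotient construction of the enveloping algebra needs only that its relations lie in the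
  free algebra, that is, closure under the operations. This weak assumption holds for a Lie
  algebra as well as for the record with the carrier replaced by a subalgebra.\<close>

locale lie_operations =
  fixes L :: "(complex, 'l) module" and br :: "'l \<Rightarrow> 'l \<Rightarrow> 'l"
  assumes add_closed: "\<lbrakk>x \<in> carrier L; y \<in> carrier L\<rbrakk> \<Longrightarrow> x \<oplus>\<^bsub>L\<^esub> y \<in> carrier L"
    and smult_closed: "x \<in> carrier L \<Longrightarrow> c \<odot>\<^bsub>L\<^esub> x \<in> carrier L"
    and br_closed: "\<lbrakk>x \<in> carrier L; y \<in> carrier L\<rbrakk> \<Longrightarrow> br x y \<in> carrier L"
begin

abbreviation F :: "('l list \<Rightarrow> complex) ring" where "F \<equiv> free_algebra (carrier L)"
abbreviation I :: "('l list \<Rightarrow> complex) set" where "I \<equiv> uea_ideal L br"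
abbreviation UL :: "('l list \<Rightarrow> complex) set ring" where "UL \<equiv> uea L br"
abbreviation cls :: "('l list \<Rightarrow> complex) \<Rightarrow> ('l list \<Rightarrow> complex) set" where "cls \<equiv> uea_class L br"

sublocale F: ring F by (rule free_algebra_ring)

lemma uea_rels_subset: "uea_rels L br \<subseteq> carrier F"
  unfolding uea_rels_def
  by (auto simp del: add_free_algebra intro!: F.minus_closed fmonom_closed simp: add_closed smult_closed br_closed)

lemma uea_ideal: "ideal I F"
  unfolding uea_ideal_def by (rule F.genideal_ideal[OF uea_rels_subset])

sublocale I: ideal I F by (rule uea_ideal)

lemma uea_rels_ideal: "r \<in> uea_rels L br \<Longrightarrow> r \<in> I"
  unfolding uea_ideal_def using F.genideal_self[OF uea_rels_subset] by blast

lemma uea_eq: "UL = F Quot I"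
  by (simp add: uea_def)

lemma cls_hom: "cls \<in> ring_hom F UL"
proof -
  have "cls = (+>\<^bsub>F\<^esub>) I" by (simp add: uea_class_def fun_eq_iff)
  then show ?thesis unfolding uea_eq using I.rcos_ring_hom by simp
qed

lemma uea_ring: "ring UL"
  unfolding uea_eq by (rule I.quotient_is_ring)

sublocale UL: ring UL by (rule uea_ring)

lemma cls_closed: "p \<in> carrier F \<Longrightarrow> cls p \<in> carrier UL"
  using ring_hom_closed[OF cls_hom] .

lemma cls_add: "\<lbrakk>p \<in> carrier F; q \<in> carrier F\<rbrakk> \<Longrightarrow> cls (\<lambda>w. p w + q w) = cls p \<oplus>\<^bsub>UL\<^esub> cls q"
  using ring_hom_add[OF cls_hom, of p q] by simp

lemma cls_mult: "\<lbrakk>p \<in> carrier F; q \<in> carrier F\<rbrakk> \<Longrightarrow> cls (p \<otimes>\<^bsub>F\<^esub> q) = cls p \<otimes>\<^bsub>UL\<^esub> cls q"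
  by (rule ring_hom_mult[OF cls_hom])

lemma uea_cases:
  assumes "a \<in> carrier UL"
  obtains p where "p \<in> carrier F" "a = cls p"
  using assms by (auto simp: uea_eq FactRing_def A_RCOSETS_def' uea_class_def)

lemma cls_letter_add:
  assumes "x \<in> carrier L" "y \<in> carrier L"
  shows "cls (fmonom 1 [x \<oplus>\<^bsub>L\<^esub> y]) = cls (fmonom 1 [x]) \<oplus>\<^bsub>UL\<^esub> cls (fmonom 1 [y])"
proof -
  have mem: "fmonom 1 [x \<oplus>\<^bsub>L\<^esub> y] \<in> carrier F" "fmonom 1 [x] \<in> carrier F" "fmonom 1 [y] \<in> carrier F"
    using assms by (simp_all add: add_closed)
  have "fmonom 1 [x \<oplus>\<^bsub>L\<^esub> y] \<ominus>\<^bsub>F\<^esub> fmonom 1 [x] \<ominus>\<^bsub>F\<^esub> fmonom 1 [y] \<in> I"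
    by (rule uea_rels_ideal) (use assms in \<open>auto simp: uea_rels_def\<close>)
  also have "fmonom 1 [x \<oplus>\<^bsub>L\<^esub> y] \<ominus>\<^bsub>F\<^esub> fmonom 1 [x] \<ominus>\<^bsub>F\<^esub> fmonom 1 [y] =
      fmonom 1 [x \<oplus>\<^bsub>L\<^esub> y] \<ominus>\<^bsub>F\<^esub> (fmonom 1 [x] \<oplus>\<^bsub>F\<^esub> fmonom 1 [y])"
    using mem F.add.m_closed[OF mem(2,3)] by (simp add: minus_free_algebra free_algebra_add_closed fun_eq_iff)
  finally have "cls (fmonom 1 [x \<oplus>\<^bsub>L\<^esub> y]) = cls (fmonom 1 [x] \<oplus>\<^bsub>F\<^esub> fmonom 1 [y])"
    unfolding uea_class_def using mem F.add.m_closed[OF mem(2,3)]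
    by (intro quotient_coset_eqI[OF uea_ideal]) simp_all
  also have "\<dots> = cls (fmonom 1 [x]) \<oplus>\<^bsub>UL\<^esub> cls (fmonom 1 [y])"
    by (rule ring_hom_add[OF cls_hom mem(2,3)])
  finally show ?thesis .
qed

lemma uea_ideal_augmentation:
  assumes "p \<in> I" shows "p [] = 0"
proof -
  have "uea_rels L br \<subseteq> {p \<in> carrier F. p [] = 0}"
  proof
    fix r assume r: "r \<in> uea_rels L br"
    then have "r [] = 0"
      unfolding uea_rels_def
      by (auto simp: minus_free_algebra add_closed smult_closed br_closed) (simp_all add: fmonom_def)
    then show "r \<in> {p \<in> carrier F. p [] = 0}" using r uea_rels_subset by blast
  qed
  then have "I \<subseteq> {p \<in> carrier F. p [] = 0}"
    unfolding uea_ideal_def by (rule F.genideal_minimal[OF augmentation_ideal])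
  then show ?thesis using assms by blast
qed

lemma cls_mem:
  assumes "p \<in> carrier F" "q \<in> cls p"
  obtains i where "i \<in> I" "q = (\<lambda>w. i w + p w)" "q \<in> carrier F"
  using assms I.a_elemrcos_carrier[of p q]
  by (auto simp: uea_class_def a_r_coset_def' intro: free_algebra_add_closed)

lemma cls_self: "p \<in> carrier F \<Longrightarrow> p \<in> cls p"
  unfolding uea_class_def by (rule I.a_rcos_self)

lemma counit_cls:
  assumes "p \<in> carrier F"
  shows "uea_counit (cls p) = p []"
proof -
  have "q [] = p []" if q: "q \<in> cls p" for q
    using cls_mem[OF assms q] uea_ideal_augmentation by (metis add_0)
  then have "(\<lambda>q. q []) ` cls p = {p []}"
    using cls_self[OF assms] by blast
  then show ?thesis by (simp add: uea_counit_def)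
qed

end

locale lie_subalgebra = lie_algebra L br for L :: "(complex, 'l) module" and br :: "'l \<Rightarrow> 'l \<Rightarrow> 'l" +
  fixes H :: "'l set"
  assumes submodule_H: "submodule H CC L"
    and br_closed_H: "\<lbrakk>x \<in> H; y \<in> H\<rbrakk> \<Longrightarrow> br x y \<in> H"
begin

abbreviation LH :: "(complex, 'l) module" where "LH \<equiv> L\<lparr>carrier := H\<rparr>"

lemma H_subset: "H \<subseteq> carrier L"
  using submoduleE(1)[OF submodule_H] .

sublocale lie_operations L br
  by unfold_locales (simp_all add: br_closed)

lemma lie_operations_LH: "lie_operations LH br"
  by unfold_locales (use submoduleE[OF submodule_H] in \<open>simp_all add: br_closed_H\<close>)

sublocale H: lie_operations LH br
  by (rule lie_operations_LH)

lemma FH_subset: "p \<in> carrier H.F \<Longrightarrow> p \<in> carrier F"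
  using H_subset by (auto simp: carrier_free_algebra)

text \<open>Each defining relation of \<open>U(H)\<close> is one of \<open>U(L)\<close>.\<close>

lemma uea_ideal_mono: "H.I \<subseteq> I"
proof -
  have minus: "p \<ominus>\<^bsub>H.F\<^esub> q = p \<ominus>\<^bsub>F\<^esub> q" if "q \<in> carrier H.F" for p q
    using that FH_subset[OF that] by (simp add: minus_free_algebra)
  have letters: "fmonom c w \<in> carrier H.F" if "set w \<subseteq> H" for c w
    using that by simp
  have "uea_rels LH br \<subseteq> I \<inter> carrier H.F"
  proof
    fix r assume r: "r \<in> uea_rels LH br"
    then consider
        (add) x y where "x \<in> H" "y \<in> H"
          "r = fmonom 1 [x \<oplus>\<^bsub>L\<^esub> y] \<ominus>\<^bsub>H.F\<^esub> fmonom 1 [x] \<ominus>\<^bsub>H.F\<^esub> fmonom 1 [y]"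
      | (smult) c x where "x \<in> H" "r = fmonom 1 [c \<odot>\<^bsub>L\<^esub> x] \<ominus>\<^bsub>H.F\<^esub> fmonom c [x]"
      | (br) x y where "x \<in> H" "y \<in> H"
          "r = fmonom 1 [x, y] \<ominus>\<^bsub>H.F\<^esub> fmonom 1 [y, x] \<ominus>\<^bsub>H.F\<^esub> fmonom 1 [br x y]"
      unfolding uea_rels_def by fastforce
    then have "r \<in> uea_rels L br"
    proof cases
      case add
      then have "r = fmonom 1 [x \<oplus>\<^bsub>L\<^esub> y] \<ominus>\<^bsub>F\<^esub> fmonom 1 [x] \<ominus>\<^bsub>F\<^esub> fmonom 1 [y]"
        by (simp only: minus letters list.set insert_subset empty_subsetI simp_thms)
      then show ?thesis unfolding uea_rels_def using add(1,2) H_subset by blast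
    next
      case smult
      then have "r = fmonom 1 [c \<odot>\<^bsub>L\<^esub> x] \<ominus>\<^bsub>F\<^esub> fmonom c [x]"
        by (simp only: minus letters list.set insert_subset empty_subsetI simp_thms)
      then show ?thesis unfolding uea_rels_def using smult(1) H_subset by blast
    next
      case br
      then have "r = fmonom 1 [x, y] \<ominus>\<^bsub>F\<^esub> fmonom 1 [y, x] \<ominus>\<^bsub>F\<^esub> fmonom 1 [br x y]"
        by (simp only: minus letters br_closed_H list.set insert_subset empty_subsetI simp_thms)
      then show ?thesis unfolding uea_rels_def using br(1,2) H_subset by blast
    qed
    then show "r \<in> I \<inter> carrier H.F"
      using uea_rels_ideal H.uea_rels_subset r by blast
  qed
  moreover have "ideal (I \<inter> carrier H.F) H.F"
    using ideal_restrict_free_algebra[OF uea_ideal H_subset] by simp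
  ultimately have "H.I \<subseteq> I \<inter> carrier H.F"
    unfolding uea_ideal_def[of LH] by (intro H.F.genideal_minimal)
  then show ?thesis by blast
qed

lemma incl_cls:
  assumes p: "p \<in> carrier H.F"
  shows "uea_incl L br (H.cls p) = cls p"
proof -
  have "cls q = cls p" if q: "q \<in> H.cls p" for q
  proof -
    obtain i where i: "i \<in> H.I" "q = (\<lambda>w. i w + p w)" "q \<in> carrier H.F"
      using H.cls_mem[OF p q] .
    have "q \<ominus>\<^bsub>F\<^esub> p = i"
      using i p FH_subset by (simp add: minus_free_algebra)
    then have "q \<ominus>\<^bsub>F\<^esub> p \<in> I" using i(1) uea_ideal_mono by blast
    then show ?thesis
      unfolding uea_class_def using p i(3) FH_subset by (intro quotient_coset_eqI[OF uea_ideal])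
  qed
  then show ?thesis
    using H.cls_self[OF p] unfolding uea_incl_def by blast
qed

end

section \<open>Induced modules\<close>

context lie_subalgebra
begin

abbreviation ten_base :: "(('l list \<Rightarrow> complex) set \<times> complex) set" where
  "ten_base \<equiv> carrier UL \<times> UNIV"

abbreviation ten_rels :: "(('l list \<Rightarrow> complex) set \<times> complex \<Rightarrow>\<^sub>0 int) set" where
  "ten_rels \<equiv> tensor_rels UL CC (carrier H.UL)
     (\<lambda>a b. a \<otimes>\<^bsub>UL\<^esub> uea_incl L br b) (\<lambda>b z. uea_counit b * z)"

abbreviation K :: "(('l list \<Rightarrow> complex) set \<times> complex \<Rightarrow>\<^sub>0 int) set" where
  "K \<equiv> induced_kernel L br H"

abbreviation V :: "(complex, 'l induced) module" where "V \<equiv> induced_module L br H"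

abbreviation icls :: "(('l list \<Rightarrow> complex) set \<times> complex \<Rightarrow>\<^sub>0 int) \<Rightarrow> 'l induced" where
  "icls \<equiv> induced_class L br H"

lemma incl_closed: "b \<in> carrier H.UL \<Longrightarrow> uea_incl L br b \<in> carrier UL"
  by (metis H.uea_cases FH_subset cls_closed incl_cls)

lemma ten_relE:
  assumes "r \<in> ten_rels"
  obtains
    (left) a a' z where "a \<in> carrier UL" "a' \<in> carrier UL"
      "r = frag_of (a \<oplus>\<^bsub>UL\<^esub> a', z) - frag_of (a, z) - frag_of (a', z)"
  | (right) a z z' where "a \<in> carrier UL"
      "r = frag_of (a, z + z') - frag_of (a, z) - frag_of (a, z')"
  | (balance) a b z where "a \<in> carrier UL" "b \<in> carrier H.UL"
      "r = frag_of (a \<otimes>\<^bsub>UL\<^esub> uea_incl L br b, z) - frag_of (a, uea_counit b * z)"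
  using assms unfolding tensor_rels_def add_CC carrier_CC by blast

lemma ten_rel_left: "\<lbrakk>a \<in> carrier UL; a' \<in> carrier UL\<rbrakk> \<Longrightarrow>
    frag_of (a \<oplus>\<^bsub>UL\<^esub> a', z) - frag_of (a, z) - frag_of (a', z) \<in> ten_rels"
  unfolding tensor_rels_def add_CC carrier_CC by blast

lemma ten_rel_right: "a \<in> carrier UL \<Longrightarrow>
    frag_of (a, z + z') - frag_of (a, z) - frag_of (a, z') \<in> ten_rels"
  unfolding tensor_rels_def add_CC carrier_CC by blast

lemma ten_rel_balance: "\<lbrakk>a \<in> carrier UL; b \<in> carrier H.UL\<rbrakk> \<Longrightarrow>
    frag_of (a \<otimes>\<^bsub>UL\<^esub> uea_incl L br b, z) - frag_of (a, uea_counit b * z) \<in> ten_rels"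
  unfolding tensor_rels_def add_CC carrier_CC by blast

lemma keys_diff_subset:
  "\<lbrakk>Poly_Mapping.keys p \<subseteq> A; Poly_Mapping.keys q \<subseteq> A\<rbrakk> \<Longrightarrow> Poly_Mapping.keys (p - q) \<subseteq> A"
  for p q :: "'b \<Rightarrow>\<^sub>0 int"
  using keys_diff[of p q] by blast

lemma ten_rels_subset: "r \<in> ten_rels \<Longrightarrow> Poly_Mapping.keys r \<subseteq> ten_base"
  by (erule ten_relE; hypsubst; intro keys_diff_subset)
    (simp_all add: keys_frag_of incl_closed)

lemma K_eq: "K = generate (free_Abelian_group ten_base) ten_rels"
  by (simp add: induced_kernel_def)

lemma K_subgroup: "subgroup K (free_Abelian_group ten_base)"
  unfolding K_eq by (rule group.generate_is_subgroup) (auto dest: ten_rels_subset)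

lemma K_zero: "0 \<in> K"
  using subgroup.one_closed[OF K_subgroup] by simp

lemma K_add: "\<lbrakk>p \<in> K; q \<in> K\<rbrakk> \<Longrightarrow> p + q \<in> K"
  using subgroup.m_closed[OF K_subgroup, of p q] by simp

lemma K_keys: "p \<in> K \<Longrightarrow> Poly_Mapping.keys p \<subseteq> ten_base"
  using subgroup.mem_carrier[OF K_subgroup, of p] by simp

lemma K_uminus: "p \<in> K \<Longrightarrow> - p \<in> K"
  using subgroup.m_inv_closed[OF K_subgroup, of p] K_keys[of p] by simp

lemma K_diff: "\<lbrakk>p \<in> K; q \<in> K\<rbrakk> \<Longrightarrow> p - q \<in> K"
  using K_add[of p "- q"] K_uminus[of q] by simp

lemma K_rel: "r \<in> ten_rels \<Longrightarrow> r \<in> K"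
  unfolding K_eq by (rule generate.incl)

lemma icls_eq: "icls p = (\<lambda>k. k + p) ` K"
  by (auto simp: induced_class_def r_coset_def)

lemma icls_eqI:
  assumes "p - q \<in> K" shows "icls p = icls q"
proof -
  have "k + p \<in> icls q" if "k \<in> K" for k
    unfolding icls_eq using K_add[OF that assms] by (intro image_eqI[of _ _ "k + (p - q)"]) simp_all
  moreover have "k + q \<in> icls p" if "k \<in> K" for k
    unfolding icls_eq using K_diff[OF that assms] by (intro image_eqI[of _ _ "k - (p - q)"]) simp_all
  ultimately show ?thesis unfolding icls_eq by blast
qed

lemma carrier_induced: "carrier V = icls ` {p. Poly_Mapping.keys p \<subseteq> ten_base}"
  by (auto simp: induced_module_def Let_def FactGroup_def RCOSETS_def induced_class_def)

lemma zero_induced: "\<zero>\<^bsub>V\<^esub> = icls 0"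
  by (simp add: induced_module_def FactGroup_def icls_eq)

lemma add_induced: "icls p \<oplus>\<^bsub>V\<^esub> icls q = icls (p + q)"
proof -
  have "icls p \<oplus>\<^bsub>V\<^esub> icls q = (\<Union>x\<in>icls p. \<Union>y\<in>icls q. {x + y})"
    by (simp add: induced_module_def FactGroup_def set_mult_def)
  also have "\<dots> = icls (p + q)"
  proof (intro equalityI subsetI)
    fix t assume "t \<in> (\<Union>x\<in>icls p. \<Union>y\<in>icls q. {x + y})"
    then obtain k k' where "k \<in> K" "k' \<in> K" "t = (k + p) + (k' + q)"
      unfolding icls_eq by blast
    then show "t \<in> icls (p + q)"
      unfolding icls_eq by (intro image_eqI[of _ _ "k + k'"]) (simp_all add: K_add)
  next
    fix t assume "t \<in> icls (p + q)"
    then obtain k where "k \<in> K" "t = (k + p) + (0 + q)"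
      unfolding icls_eq by (auto simp: add.assoc)
    then show "t \<in> (\<Union>x\<in>icls p. \<Union>y\<in>icls q. {x + y})"
      unfolding icls_eq using K_zero by blast
  qed
  finally show ?thesis .
qed

lemma frag_extend_K:
  assumes f: "\<And>r. r \<in> ten_rels \<Longrightarrow> frag_extend f r \<in> K" and "k \<in> K"
  shows "frag_extend f k \<in> K"
  using assms(2) unfolding K_eq
proof (induction k rule: generate.induct)
  case one
  then show ?case using K_zero by (simp add: K_eq)
next
  case (incl h)
  then show ?case using f by (simp add: K_eq)
next
  case (inv h)
  then show ?case
    using K_uminus[OF f[OF inv]] ten_rels_subset[OF inv] by (simp add: K_eq frag_extend_minus)
next
  case (eng h1 h2)
  then show ?case
    using K_add[of "frag_extend f h1" "frag_extend f h2"] by (simp add: K_eq frag_extend_add)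
qed

text \<open>\<open>induced_map\<close> is a union over all representatives of a class. These differ by
  relations, whose images are again relations, so they all contribute the same class.\<close>

lemma induced_map_icls:
  assumes "\<And>r. r \<in> ten_rels \<Longrightarrow> frag_extend (\<lambda>q. frag_of (h q)) r \<in> K"
  shows "induced_map L br H h (icls p) = icls (frag_extend (\<lambda>q. frag_of (h q)) p)"
proof -
  let ?f = "frag_extend (\<lambda>q. frag_of (h q))"
  have "icls (?f q) = icls (?f p)" if q: "q \<in> icls p" for q
  proof -
    obtain k where "k \<in> K" "q = k + p" using q unfolding icls_eq by blast
    then have "?f q - ?f p = ?f k" by (simp add: frag_extend_add)
    then show ?thesis
      using frag_extend_K[OF assms \<open>k \<in> K\<close>] by (intro icls_eqI) simp
  qed
  moreover have "p \<in> icls p" unfolding icls_eq using K_zero by (intro image_eqI[of _ _ 0]) simp_all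
  ultimately show ?thesis unfolding induced_map_def by blast
qed

abbreviation letter :: "'l \<Rightarrow> ('l list \<Rightarrow> complex) set" where "letter x \<equiv> cls (fmonom 1 [x])"

lemma letter_closed: "x \<in> carrier L \<Longrightarrow> letter x \<in> carrier UL"
  by (rule cls_closed) simp

abbreviation act_ext :: "'l \<Rightarrow> (('l list \<Rightarrow> complex) set \<times> complex \<Rightarrow>\<^sub>0 int) \<Rightarrow> (('l list \<Rightarrow> complex) set \<times> complex \<Rightarrow>\<^sub>0 int)" where
  "act_ext x \<equiv> frag_extend (\<lambda>q. frag_of (case q of (a, z) \<Rightarrow> (letter x \<otimes>\<^bsub>UL\<^esub> a, z)))"

text \<open>Left multiplication by a letter commutes with right multiplication by \<open>U(H)\<close>,
  so it respects the balancing relations.\<close>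

lemma act_icls:
  assumes x: "x \<in> carrier L"
  shows "induced_act L br H x (icls p) = icls (act_ext x p)"
  unfolding induced_act_def
proof (rule induced_map_icls)
  fix r assume "r \<in> ten_rels"
  then show "act_ext x r \<in> K"
  proof (cases rule: ten_relE)
    case (left a a' z)
    then show ?thesis
      using letter_closed[OF x] K_rel[OF ten_rel_left[of "letter x \<otimes>\<^bsub>UL\<^esub> a" "letter x \<otimes>\<^bsub>UL\<^esub> a'" z]]
      by (simp add: frag_extend_diff UL.r_distr)
  next
    case (right a z z')
    then show ?thesis
      using letter_closed[OF x] K_rel[OF ten_rel_right[of "letter x \<otimes>\<^bsub>UL\<^esub> a" z z']]
      by (simp add: frag_extend_diff)
  next
    case (balance a b z)
    then show ?thesis
      using letter_closed[OF x] K_rel[OF ten_rel_balance[of "letter x \<otimes>\<^bsub>UL\<^esub> a" b z]]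
      by (simp add: frag_extend_diff UL.m_assoc incl_closed)
  qed
qed

lemma smult_icls:
  "c \<odot>\<^bsub>V\<^esub> icls p = icls (frag_extend (\<lambda>q. frag_of (case q of (a, z) \<Rightarrow> (a, c * z))) p)"
proof -
  have "c \<odot>\<^bsub>V\<^esub> icls p = induced_map L br H (\<lambda>(a, z). (a, c * z)) (icls p)"
    by (simp add: induced_module_def Let_def)
  also have "\<dots> = icls (frag_extend (\<lambda>q. frag_of (case q of (a, z) \<Rightarrow> (a, c * z))) p)"
  proof (rule induced_map_icls)
    fix r assume "r \<in> ten_rels"
    then show "frag_extend (\<lambda>q. frag_of (case q of (a, z) \<Rightarrow> (a, c * z))) r \<in> K"
    proof (cases rule: ten_relE)
      case (left a a' z)
      then show ?thesis
        using K_rel[OF ten_rel_left[of a a' "c * z"]] by (simp add: frag_extend_diff)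
    next
      case (right a z z')
      then show ?thesis
        using K_rel[OF ten_rel_right[of a "c * z" "c * z'"]]
        by (simp add: frag_extend_diff distrib_left)
    next
      case (balance a b z)
      then show ?thesis
        using K_rel[OF ten_rel_balance[of a b "c * z"]]
        by (simp add: frag_extend_diff mult.left_commute)
    qed
  qed
  finally show ?thesis .
qed

lemma keys_act_ext:
  assumes "x \<in> carrier L" "Poly_Mapping.keys p \<subseteq> ten_base"
  shows "Poly_Mapping.keys (act_ext x p) \<subseteq> ten_base"
proof -
  have "Poly_Mapping.keys (act_ext x p) \<subseteq>
      (\<Union>q\<in>Poly_Mapping.keys p. {case q of (a, z) \<Rightarrow> (letter x \<otimes>\<^bsub>UL\<^esub> a, z)})"
    using keys_frag_extend[of "\<lambda>q. frag_of (case q of (a, z) \<Rightarrow> (letter x \<otimes>\<^bsub>UL\<^esub> a, z))" p]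
    by (simp only: keys_frag_of)
  also have "\<dots> \<subseteq> ten_base"
    using assms letter_closed by auto
  finally show ?thesis .
qed

lemma induced_act_closed:
  assumes "x \<in> carrier L" "v \<in> carrier V"
  shows "induced_act L br H x v \<in> carrier V"
  using assms keys_act_ext by (auto simp: carrier_induced act_icls)

lemma induced_act_add:
  assumes x: "x \<in> carrier L" and y: "y \<in> carrier L" and "v \<in> carrier V"
  shows "induced_act L br H (x \<oplus>\<^bsub>L\<^esub> y) v = induced_act L br H x v \<oplus>\<^bsub>V\<^esub> induced_act L br H y v"
proof -
  obtain p where p: "Poly_Mapping.keys p \<subseteq> ten_base" "v = icls p"
    using assms(3) by (auto simp: carrier_induced)
  have "act_ext (x \<oplus>\<^bsub>L\<^esub> y) p - (act_ext x p + act_ext y p) \<in> K"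
    using p(1)
  proof (induction p rule: frag_induction)
    case zero
    show ?case using K_zero by simp
  next
    case (one q)
    then obtain a z where "q = (a, z)" "a \<in> carrier UL" by auto
    then show ?case
      using K_rel[OF ten_rel_left[of "letter x \<otimes>\<^bsub>UL\<^esub> a" "letter y \<otimes>\<^bsub>UL\<^esub> a" z]]
        letter_closed[OF x] letter_closed[OF y]
      by (simp add: cls_letter_add x y UL.l_distr diff_diff_eq)
  next
    case (diff a b)
    have "act_ext (x \<oplus>\<^bsub>L\<^esub> y) (a - b) - (act_ext x (a - b) + act_ext y (a - b)) =
        (act_ext (x \<oplus>\<^bsub>L\<^esub> y) a - (act_ext x a + act_ext y a)) -
        (act_ext (x \<oplus>\<^bsub>L\<^esub> y) b - (act_ext x b + act_ext y b))"
      by (simp add: frag_extend_diff)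
    then show ?case using K_diff[OF diff] by simp
  qed
  then show ?thesis
    unfolding p(2) by (simp add: act_icls x y add_closed add_induced icls_eqI)
qed

text \<open>A pure tensor \<open>a \<otimes> z\<close> is \<open>z\<close> times \<open>a \<otimes>
  1\<close>, and \<open>a\<close> is a sum of words with coefficients; the letters of a word
  act one after the other on the tensor obtained from the empty word. That last one, \<open>c
  1 \<otimes> 1\<close>, equals \<open>c\<close> times \<open>1 \<otimes> 1\<close> by the
  balancing relation for the scalar \<open>c \<in> U(H)\<close>, whose counit is
  \<open>c\<close>.\<close>

theorem induced_cyclic:
  assumes N: "submodule N CC V"
    and act: "\<And>x v. x \<in> carrier L \<Longrightarrow> v \<in> N \<Longrightarrow> induced_act L br H x v \<in> N"
    and vec: "induced_vec L br H \<in> N"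
    and v: "v \<in> carrier V"
  shows "v \<in> N"
proof -
  have N_add: "s \<oplus>\<^bsub>V\<^esub> t \<in> N" if "s \<in> N" "t \<in> N" for s t
    using subgroup.m_closed[OF submodule.axioms(1)[OF N] that] by simp
  have N_smult: "c \<odot>\<^bsub>V\<^esub> t \<in> N" if "t \<in> N" for c t
    using submodule.smult_closed[OF N, of c t] that by simp
  have N_zero: "icls 0 \<in> N"
    using subgroup.one_closed[OF submodule.axioms(1)[OF N]] by (simp add: zero_induced)
  \<comment> \<open>Additivity with both summands zero reads \<open>0 \<otimes> z = 0 \<otimes> z + 0 \<otimes> z\<close>.\<close>
  have zero_left: "frag_of (\<zero>\<^bsub>UL\<^esub>, z) \<in> K" for z
    using K_uminus[OF K_rel[OF ten_rel_left[of "\<zero>\<^bsub>UL\<^esub>" "\<zero>\<^bsub>UL\<^esub>" z]]] by simp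
  have zero_right: "frag_of (a, 0) \<in> K" if "a \<in> carrier UL" for a
    using K_uminus[OF K_rel[OF ten_rel_right[of a 0 0]]] that by simp
  have word: "icls (frag_of (cls (fmonom c w), 1)) \<in> N" if "set w \<subseteq> carrier L" for c w
    using that
  proof (induction w)
    case Nil
    let ?b = "H.cls (fmonom c [])"
    have b: "?b \<in> carrier H.UL" by (rule H.cls_closed) simp
    have "cls (fmonom c []) = \<one>\<^bsub>UL\<^esub> \<otimes>\<^bsub>UL\<^esub> uea_incl L br ?b"
      using incl_closed[OF b] by (simp add: incl_cls)
    then have "frag_of (cls (fmonom c []), 1) - frag_of (\<one>\<^bsub>UL\<^esub>, uea_counit ?b * 1) \<in> K"
      using K_rel[OF ten_rel_balance[OF _ b, of "\<one>\<^bsub>UL\<^esub>" 1]] by simp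
    then have "icls (frag_of (cls (fmonom c []), 1)) = icls (frag_of (\<one>\<^bsub>UL\<^esub>, uea_counit ?b * 1))"
      by (rule icls_eqI)
    also have "uea_counit ?b = c"
      by (subst H.counit_cls) (simp_all, simp add: fmonom_def)
    also have "icls (frag_of (\<one>\<^bsub>UL\<^esub>, c * 1)) = c \<odot>\<^bsub>V\<^esub> induced_vec L br H"
      by (simp add: induced_vec_def smult_icls)
    finally show ?case using N_smult[OF vec] by simp
  next
    case (Cons x w)
    have "cls (fmonom c (x # w)) = letter x \<otimes>\<^bsub>UL\<^esub> cls (fmonom c w)"
      using Cons.prems by (subst cls_mult[symmetric]) simp_all
    then have "icls (frag_of (cls (fmonom c (x # w)), 1)) =
        induced_act L br H x (icls (frag_of (cls (fmonom c w), 1)))"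
      using Cons.prems by (simp add: act_icls)
    then show ?case using Cons act by simp
  qed
  have pure1: "icls (frag_of (cls p, 1)) \<in> N" if "p \<in> carrier F" for p
    using that
  proof (induction p rule: free_algebra_induct)
    case zero
    have "cls (\<lambda>w. 0) = \<zero>\<^bsub>UL\<^esub>"
      using ring_hom_zero[OF cls_hom F.ring_axioms UL.ring_axioms] by simp
    then have "icls (frag_of (cls (\<lambda>w. 0), 1)) = icls 0"
      using zero_left by (intro icls_eqI) simp
    then show ?case using N_zero by simp
  next
    case (add p c w)
    have "cls (\<lambda>v. fmonom c w v + p v) = cls (fmonom c w) \<oplus>\<^bsub>UL\<^esub> cls p"
      using add by (intro cls_add) simp_all
    then have "icls (frag_of (cls (\<lambda>v. fmonom c w v + p v), 1)) =
        icls (frag_of (cls (fmonom c w), 1)) \<oplus>\<^bsub>V\<^esub> icls (frag_of (cls p, 1))"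
      using K_rel[OF ten_rel_left[of "cls (fmonom c w)" "cls p" 1]] add
      unfolding add_induced by (intro icls_eqI) (simp add: cls_closed diff_diff_eq)
    then show ?case using add word N_add by simp
  qed
  have pure: "icls (frag_of (a, z)) \<in> N" if a: "a \<in> carrier UL" for a z
  proof -
    obtain p where p: "p \<in> carrier F" "a = cls p" using uea_cases[OF a] .
    have "icls (frag_of (a, z)) = z \<odot>\<^bsub>V\<^esub> icls (frag_of (a, 1))"
      by (simp add: smult_icls)
    then show ?thesis using N_smult pure1[OF p(1)] p(2) by simp
  qed
  obtain p where p: "Poly_Mapping.keys p \<subseteq> ten_base" "v = icls p"
    using v by (auto simp: carrier_induced)
  \<comment> \<open>Induction over the free abelian group produces differences, so negatives are carried along.\<close>
  have "icls p \<in> N \<and> icls (- p) \<in> N"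
    using p(1)
  proof (induction p rule: frag_induction)
    case zero
    show ?case using N_zero by simp
  next
    case (one q)
    then obtain a z where q: "q = (a, z)" "a \<in> carrier UL" by auto
    have "frag_of (a, z) + frag_of (a, - z) \<in> K"
      using K_diff[OF zero_right[OF q(2)] K_rel[OF ten_rel_right[OF q(2), of z "- z"]]]
      by (simp add: add.commute)
    from K_uminus[OF this] have "- frag_of (a, z) - frag_of (a, - z) \<in> K" by simp
    then have "icls (- frag_of (a, z)) = icls (frag_of (a, - z))" by (rule icls_eqI)
    then show ?case using q pure by simp
  next
    case (diff a b)
    have "icls (a - b) = icls a \<oplus>\<^bsub>V\<^esub> icls (- b)" "icls (- (a - b)) = icls b \<oplus>\<^bsub>V\<^esub> icls (- a)"
      by (simp_all add: add_induced)
    then show ?case using diff N_add by simp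
  qed
  then show ?thesis using p(2) by simp
qed

end

section \<open>The nonnegative modes form a Lie subalgebra\<close>

text \<open>The coefficient of \<open>x\<^sup>m\<close> in \<open>\<Delta>\<^bsup>(l)\<^esup>\<close> is
  \<open>(m+1)\<cdots>(m+l) y\<^bsup>-m-l-1\<^esup>\<close>, which vanishes for \<open>-l
  \<le> m < 0\<close>. So for \<open>m < 0\<close> only nonnegative powers of \<open>y\<close>
  occur.\<close>

lemma fd_Delta_support:
  assumes "fd_Delta l m n \<noteq> 0"
  shows "n = - 1 - int l - m" "m \<ge> 0 \<or> m + int l < 0"
proof -
  have "n = - 1 - int l - m \<and> (m \<ge> 0 \<or> m + int l < 0)"
    using assms
  proof (induction l arbitrary: m)
    case 0
    then show ?case by (auto simp: fd_Delta_def split: if_splits)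
  next
    case (Suc l)
    have "fd_Delta (Suc l) m n = of_int (m + 1) * fd_Delta l (m + 1) n"
      by (simp add: fd_Delta_def fd_pderiv_x_def)
    with Suc.prems have "m + 1 \<noteq> 0" "fd_Delta l (m + 1) n \<noteq> 0"
      by (auto simp del: of_int_add)
    with Suc.IH[of "m + 1"] show ?case by auto
  qed
  then show "n = - 1 - int l - m" "m \<ge> 0 \<or> m + int l < 0" by auto
qed

context local_vertex_lie_algebra
begin

abbreviation Lp :: "'l set" where "Lp \<equiv> Lplus U \<rho>"

lemma lmonom_closed: "u \<in> carrier U \<Longrightarrow> lmonom U u n \<in> carrier (laurent U)"
  by (auto simp: laurent_def lmonom_def)

lemma rho_closed: "p \<in> carrier (laurent U) \<Longrightarrow> \<rho> p \<in> carrier L"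
  using rho_linear by (auto simp: linear_map_def)

lemma umode_closed: "u \<in> carrier U \<Longrightarrow> umode U \<rho> u n \<in> carrier L"
  by (simp add: umode_def rho_closed lmonom_closed)

lemma rho_add: "\<lbrakk>p \<in> carrier (laurent U); q \<in> carrier (laurent U)\<rbrakk> \<Longrightarrow>
    \<rho> (\<lambda>n. p n \<oplus>\<^bsub>U\<^esub> q n) = \<rho> p \<oplus>\<^bsub>L\<^esub> \<rho> q"
  using rho_linear by (simp add: linear_map_def laurent_def)

lemma rho_smult: "p \<in> carrier (laurent U) \<Longrightarrow> \<rho> (\<lambda>n. c \<odot>\<^bsub>U\<^esub> p n) = c \<odot>\<^bsub>L\<^esub> \<rho> p"
  using rho_linear by (simp add: linear_map_def laurent_def)

lemma laurent_add_closed: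
  assumes "p \<in> carrier (laurent U)" "q \<in> carrier (laurent U)"
  shows "(\<lambda>n. p n \<oplus>\<^bsub>U\<^esub> q n) \<in> carrier (laurent U)"
proof -
  have "{n. p n \<oplus>\<^bsub>U\<^esub> q n \<noteq> \<zero>\<^bsub>U\<^esub>} \<subseteq> {n. p n \<noteq> \<zero>\<^bsub>U\<^esub>} \<union> {n. q n \<noteq> \<zero>\<^bsub>U\<^esub>}" by auto
  moreover have "finite ({n. p n \<noteq> \<zero>\<^bsub>U\<^esub>} \<union> {n. q n \<noteq> \<zero>\<^bsub>U\<^esub>})"
    using assms by (simp add: laurent_def)
  ultimately have "finite {n. p n \<oplus>\<^bsub>U\<^esub> q n \<noteq> \<zero>\<^bsub>U\<^esub>}" by (rule finite_subset)
  then show ?thesis using assms by (simp add: laurent_def)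
qed

lemma laurent_smult_closed:
  assumes "p \<in> carrier (laurent U)"
  shows "(\<lambda>n. c \<odot>\<^bsub>U\<^esub> p n) \<in> carrier (laurent U)"
proof -
  have "{n. c \<odot>\<^bsub>U\<^esub> p n \<noteq> \<zero>\<^bsub>U\<^esub>} \<subseteq> {n. p n \<noteq> \<zero>\<^bsub>U\<^esub>}"
    using U.smult_r_null[of c] by auto
  moreover have "finite {n. p n \<noteq> \<zero>\<^bsub>U\<^esub>}"
    using assms by (simp add: laurent_def)
  ultimately have "finite {n. c \<odot>\<^bsub>U\<^esub> p n \<noteq> \<zero>\<^bsub>U\<^esub>}" by (rule finite_subset)
  then show ?thesis using assms by (simp add: laurent_def)
qed

text \<open>\<open>L\<close> is spanned by the modes: a Laurent polynomial is a finite sum of monomials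
  with exponents in its support.\<close>

lemma rho_induct [consumes 3, case_names mode add]:
  assumes p: "p \<in> carrier (laurent U)" and supp: "\<And>n. p n \<noteq> \<zero>\<^bsub>U\<^esub> \<Longrightarrow> n \<in> A" and A: "z \<in> A"
    and mode: "\<And>u n. \<lbrakk>u \<in> carrier U; n \<in> A\<rbrakk> \<Longrightarrow> P (umode U \<rho> u n)"
    and add: "\<And>x y. \<lbrakk>x \<in> carrier L; y \<in> carrier L; P x; P y\<rbrakk> \<Longrightarrow> P (x \<oplus>\<^bsub>L\<^esub> y)"
  shows "P (\<rho> p)"
proof -
  have "finite B \<Longrightarrow> B \<subseteq> A \<Longrightarrow> p \<in> carrier (laurent U) \<Longrightarrow> (\<And>n. n \<notin> B \<Longrightarrow> p n = \<zero>\<^bsub>U\<^esub>) \<Longrightarrow> P (\<rho> p)"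
    for B and p :: "int \<Rightarrow> 'u"
  proof (induction B arbitrary: p rule: finite_induct)
    case empty
    then have "p = lmonom U \<zero>\<^bsub>U\<^esub> z" by (auto simp: lmonom_def)
    then show ?case using mode[OF U.zero_closed A] by (simp add: umode_def)
  next
    case (insert n B)
    define q where "q = p(n := \<zero>\<^bsub>U\<^esub>)"
    have pU: "p m \<in> carrier U" for m using insert.prems(2) by (simp add: laurent_def)
    have "{m. q m \<noteq> \<zero>\<^bsub>U\<^esub>} \<subseteq> {m. p m \<noteq> \<zero>\<^bsub>U\<^esub>}" by (auto simp: q_def)
    moreover have "finite {m. p m \<noteq> \<zero>\<^bsub>U\<^esub>}"
      using insert.prems(2) by (simp add: laurent_def)
    ultimately have "finite {m. q m \<noteq> \<zero>\<^bsub>U\<^esub>}" by (rule finite_subset)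
    then have q: "q \<in> carrier (laurent U)"
      using pU by (simp add: laurent_def q_def)
    have "p = (\<lambda>m. q m \<oplus>\<^bsub>U\<^esub> lmonom U (p n) n m)"
      using pU by (auto simp: q_def lmonom_def)
    then have "\<rho> p = \<rho> q \<oplus>\<^bsub>L\<^esub> umode U \<rho> (p n) n"
      using rho_add[OF q lmonom_closed[OF pU]] unfolding umode_def by metis
    moreover have "P (\<rho> q)"
      by (rule insert.IH[OF _ q]) (use insert.prems in \<open>auto simp: q_def\<close>)
    ultimately show ?case
      using add[OF rho_closed[OF q] umode_closed[OF pU] _ mode[OF pU]] insert.prems(1) by simp
  qed
  from this[of "{n. p n \<noteq> \<zero>\<^bsub>U\<^esub>}"] show ?thesis
    using p supp by (auto simp: laurent_def)
qed

lemma Lplus_subset: "Lp \<subseteq> carrier L"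
  by (auto simp: Lplus_def rho_closed)

lemma umode_Lplus: "\<lbrakk>u \<in> carrier U; n \<ge> 0\<rbrakk> \<Longrightarrow> umode U \<rho> u n \<in> Lp"
  unfolding Lplus_def umode_def by (intro imageI) (simp add: lmonom_closed, simp add: lmonom_def)

lemma submodule_Lplus: "submodule Lp CC L"
proof (rule L.submoduleI_add_smult)
  show "Lp \<noteq> {}" using umode_Lplus[OF U.zero_closed, of 0] by auto
next
  fix x y assume "x \<in> Lp" "y \<in> Lp"
  then obtain p q where p: "p \<in> carrier (laurent U)" "\<forall>n<0. p n = \<zero>\<^bsub>U\<^esub>" "x = \<rho> p"
    and q: "q \<in> carrier (laurent U)" "\<forall>n<0. q n = \<zero>\<^bsub>U\<^esub>" "y = \<rho> q"
    by (auto simp: Lplus_def)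
  then show "x \<oplus>\<^bsub>L\<^esub> y \<in> Lp"
    unfolding Lplus_def
    by (intro image_eqI[of _ _ "\<lambda>n. p n \<oplus>\<^bsub>U\<^esub> q n"]) (simp_all add: rho_add laurent_add_closed)
next
  fix c x assume "x \<in> Lp"
  then obtain p where p: "p \<in> carrier (laurent U)" "\<forall>n<0. p n = \<zero>\<^bsub>U\<^esub>" "x = \<rho> p"
    by (auto simp: Lplus_def)
  then show "c \<odot>\<^bsub>L\<^esub> x \<in> Lp"
    unfolding Lplus_def using U.smult_r_null[of c]
    by (intro image_eqI[of _ _ "\<lambda>n. c \<odot>\<^bsub>U\<^esub> p n"]) (simp_all add: rho_smult laurent_smult_closed)
qed (rule Lplus_subset)

lemma Lplus_induct [consumes 1, case_names mode add]:
  assumes "x \<in> Lp"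
    and "\<And>u n. \<lbrakk>u \<in> carrier U; n \<ge> 0\<rbrakk> \<Longrightarrow> P (umode U \<rho> u n)"
    and "\<And>x y. \<lbrakk>x \<in> carrier L; y \<in> carrier L; P x; P y\<rbrakk> \<Longrightarrow> P (x \<oplus>\<^bsub>L\<^esub> y)"
  shows "P x"
proof -
  obtain p where p: "p \<in> carrier (laurent U)" "\<forall>n<0. p n = \<zero>\<^bsub>U\<^esub>" "x = \<rho> p"
    using assms(1) by (auto simp: Lplus_def)
  have "n \<in> {0..}" if "p n \<noteq> \<zero>\<^bsub>U\<^esub>" for n
    using p(2) that by (meson atLeast_iff not_le)
  then show ?thesis
    unfolding p(3) using p(1) assms(2,3) by (intro rho_induct[of p "{0..}" 0 P]) auto
qed

text \<open>For \<open>f = u(y)\<close> the coefficients at negative powers of \<open>y\<close> are the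
  modes \<open>u(n)\<close> with \<open>n \<ge> 0\<close>, hence in \<open>L\<^sup>+\<close>.
  Differentiation preserves this: the coefficient at \<open>y\<^bsup>-1\<^esup>\<close> of a
  derivative is zero, so no coefficient at a nonnegative power is moved to a negative one.\<close>

lemma deriv_nonsingular:
  assumes "\<And>j. f j \<in> carrier L" "\<And>j. j < 0 \<Longrightarrow> f j \<in> Lp"
  shows "((fd_deriv L ^^ k) f j \<in> carrier L) \<and> (j < 0 \<longrightarrow> (fd_deriv L ^^ k) f j \<in> Lp)"
proof (induction k arbitrary: j)
  case 0
  then show ?case using assms by simp
next
  case (Suc k)
  have "fd_deriv L ((fd_deriv L ^^ k) f) j \<in> Lp" if "j < 0"
  proof (cases "j = - 1")
    case True
    then have "fd_deriv L ((fd_deriv L ^^ k) f) j = 0 \<odot>\<^bsub>L\<^esub> (fd_deriv L ^^ k) f 0"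
      by (subst fd_deriv_def) simp
    then show ?thesis
      using Suc.IH[of 0] L.smult_l_null submodule_zero_closed[OF L.module_axioms submodule_Lplus]
      by simp
  next
    case False
    then have "j + 1 < 0" using that by simp
    then show ?thesis
      unfolding fd_deriv_def[of L "(fd_deriv L ^^ k) f" j]
      using Suc.IH[of "j + 1"] L.submoduleE(4)[OF submodule_Lplus] by simp
  qed
  moreover have "fd_deriv L ((fd_deriv L ^^ k) f) j \<in> carrier L"
    unfolding fd_deriv_def[of L "(fd_deriv L ^^ k) f" j] using Suc.IH[of "j + 1"] by simp
  ultimately show ?case by simp
qed

text \<open>The bracket of \<open>u(m)\<close> and \<open>v(n)\<close> with \<open>m, n \<ge> 0\<close>
  is the coefficient of \<open>x\<^bsup>-m-1\<^esup> y\<^bsup>-n-1\<^esup>\<close> in the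
  locality formula. At a negative power of \<open>x\<close> the factor
  \<open>\<Delta>\<^bsup>(l)\<^esup>\<close> contributes only nonnegative powers of
  \<open>y\<close>, so that the other factor must contribute a negative one, whose coefficient
  is in \<open>L\<^sup>+\<close>.\<close>

lemma umode_bracket_Lplus:
  assumes "u \<in> carrier U" "v \<in> carrier U" "m \<ge> 0" "n \<ge> 0"
  shows "br (umode U \<rho> u m) (umode U \<rho> v n) \<in> Lp"
proof -
  obtain r :: nat and f k l where f: "\<And>i. i \<le> r \<Longrightarrow> f i \<in> carrier U"
    and br: "\<And>m n. br (ufield U \<rho> u m) (ufield U \<rho> v n) =
       finsum L (\<lambda>i. fd_mult_y L ((fd_deriv L ^^ k i) (ufield U \<rho> (f i))) (fd_Delta (l i)) m n) {..r}"
    using locality[OF assms(1,2)] by blast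
  have "fd_mult_y L ((fd_deriv L ^^ k i) (ufield U \<rho> (f i))) (fd_Delta (l i)) (- m - 1) (- n - 1) \<in> Lp"
    if "i \<in> {..r}" for i
  proof -
    let ?g = "(fd_deriv L ^^ k i) (ufield U \<rho> (f i))"
    have fi: "f i \<in> carrier U" using that f by simp
    have g: "?g j \<in> Lp" if "j < 0" for j
      using deriv_nonsingular[of "ufield U \<rho> (f i)" "k i" j] that umode_closed[OF fi] umode_Lplus[OF fi]
      by (simp add: ufield_def)
    show ?thesis
      unfolding fd_mult_y_def
    proof (rule submodule_finsum_closed[OF L.module_axioms submodule_Lplus])
      fix j assume "j \<in> {j. fd_Delta (l i) (- m - 1) (- n - 1 - j) \<noteq> 0}"
      then have "fd_Delta (l i) (- m - 1) (- n - 1 - j) \<noteq> 0" by simp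
      from fd_Delta_support[OF this] assms(3,4) have "j < 0" by linarith
      then show "fd_Delta (l i) (- m - 1) (- n - 1 - j) \<odot>\<^bsub>L\<^esub> ?g j \<in> Lp"
        using g L.submoduleE(4)[OF submodule_Lplus] by simp
    qed
  qed
  then have "br (ufield U \<rho> u (- m - 1)) (ufield U \<rho> v (- n - 1)) \<in> Lp"
    unfolding br by (rule submodule_finsum_closed[OF L.module_axioms submodule_Lplus])
  then show ?thesis by (simp add: ufield_def)
qed

lemma Lplus_bracket:
  assumes "x \<in> Lp" "y \<in> Lp"
  shows "br x y \<in> Lp"
  using assms(1)
proof (induction rule: Lplus_induct)
  case (mode u m)
  show ?case
    using assms(2)
  proof (induction rule: Lplus_induct)
    case (mode v n)
    then show ?case using \<open>u \<in> carrier U\<close> \<open>m \<ge> 0\<close> by (intro umode_bracket_Lplus)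
  next
    case (add s t)
    then show ?case
      using umode_closed[OF \<open>u \<in> carrier U\<close>] L.submoduleE(5)[OF submodule_Lplus]
      by (simp add: L.br_add_right)
  qed
next
  case (add s t)
  then show ?case
    using assms(2) Lplus_subset L.submoduleE(5)[OF submodule_Lplus]
    by (simp add: L.br_add_left subsetD)
qed

lemma lie_subalgebra_Lplus: "lie_subalgebra L br Lp"
  by (intro lie_subalgebra.intro lie_subalgebra_axioms.intro L.lie_algebra_axioms submodule_Lplus Lplus_bracket)

end

section \<open>The submodule defining the quotient is an ideal\<close>

locale VL_vertex_structure = local_vertex_lie_algebra L br U dom_d d \<rho>
  for L :: "(complex, 'l) module" and br :: "'l \<Rightarrow> 'l \<Rightarrow> 'l" and U :: "(complex, 'u) module"
    and dom_d :: "'u set" and d :: "'u \<Rightarrow> 'u" and \<rho> :: "(int \<Rightarrow> 'u) \<Rightarrow> 'l" +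
  fixes Y :: "'l induced \<Rightarrow> int \<Rightarrow> 'l induced \<Rightarrow> 'l induced" and lam :: "'u \<Rightarrow> complex"
  assumes vertex_structure: "is_VL_vertex_structure L br U \<rho> Y"
begin

abbreviation V :: "(complex, 'l induced) module" where "V \<equiv> VL L br U \<rho>"
abbreviation act :: "'l \<Rightarrow> 'l induced \<Rightarrow> 'l induced" where "act \<equiv> VL_act L br U \<rho>"
abbreviation vac :: "'l induced" where "vac \<equiv> VL_vac L br U \<rho>"
abbreviation mode :: "'u \<Rightarrow> int \<Rightarrow> 'l" where "mode \<equiv> umode U \<rho>"
abbreviation state :: "'u \<Rightarrow> 'l induced" where "state u \<equiv> act (mode u (- 1)) vac"
abbreviation W :: "'l induced set" where "W \<equiv> VL_lambda_sub L br U dom_d d \<rho> lam"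

sublocale VA: vertex_algebra V Y vac
  using vertex_structure by (simp add: is_VL_vertex_structure_def)

lemma Y_state: "\<lbrakk>u \<in> carrier U; v \<in> carrier V\<rbrakk> \<Longrightarrow> Y (state u) n v = act (mode u n) v"
  using vertex_structure by (simp add: is_VL_vertex_structure_def)

lemma act_closed: "\<lbrakk>x \<in> carrier L; v \<in> carrier V\<rbrakk> \<Longrightarrow> act x v \<in> carrier V"
  using lie_subalgebra.induced_act_closed[OF lie_subalgebra_Lplus] by (simp add: VL_def VL_act_def)

lemma act_add: "\<lbrakk>x \<in> carrier L; y \<in> carrier L; v \<in> carrier V\<rbrakk> \<Longrightarrow>
    act (x \<oplus>\<^bsub>L\<^esub> y) v = act x v \<oplus>\<^bsub>V\<^esub> act y v"
  using lie_subalgebra.induced_act_add[OF lie_subalgebra_Lplus] by (simp add: VL_def VL_act_def)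

lemma state_closed: "u \<in> carrier U \<Longrightarrow> state u \<in> carrier V"
  by (intro act_closed umode_closed VA.vac_closed)

text \<open>The generated submodule is defined by stability under all of \<open>L\<close>, whereas the
  vertex algebra only sees the modes; since they span \<open>L\<close> and the action is
  additive in \<open>L\<close>, the modes suffice.\<close>

lemma act_stable:
  assumes N: "submodule N CC V"
    and modes: "\<And>u n v. \<lbrakk>u \<in> carrier U; v \<in> N\<rbrakk> \<Longrightarrow> act (mode u n) v \<in> N"
    and x: "x \<in> carrier L" and v: "v \<in> N"
  shows "act x v \<in> N"
proof -
  have vV: "v \<in> carrier V" using VA.submoduleE(1)[OF N] v by blast
  obtain p where p: "p \<in> carrier (laurent U)" "x = \<rho> p" using x rho_surj by blast
  show ?thesis
    unfolding p(2)
  proof (rule rho_induct[of p UNIV 0 "\<lambda>x. act x v \<in> N"])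
    fix x y assume "x \<in> carrier L" "y \<in> carrier L" "act x v \<in> N" "act y v \<in> N"
    then show "act (x \<oplus>\<^bsub>L\<^esub> y) v \<in> N"
      using VA.submoduleE(5)[OF N] vV by (simp add: act_add)
  qed (use p v modes in simp_all)
qed

lemma cyclic:
  assumes N: "submodule N CC V"
    and modes: "\<And>u n v. \<lbrakk>u \<in> carrier U; v \<in> N\<rbrakk> \<Longrightarrow> act (mode u n) v \<in> N"
    and "vac \<in> N" "v \<in> carrier V"
  shows "v \<in> N"
  using lie_subalgebra.induced_cyclic[OF lie_subalgebra_Lplus, of N v] act_stable[OF N modes] assms
  by (simp add: VL_def VL_act_def VL_vac_def)

definition gens :: "'l induced set" where
  "gens = {state u \<ominus>\<^bsub>V\<^esub> (lam u \<odot>\<^bsub>V\<^esub> vac) | u. u \<in> ker_d U dom_d d}"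

lemma W_eq: "W = \<Inter> {N. submodule N CC V \<and> (\<forall>x\<in>carrier L. \<forall>v\<in>N. act x v \<in> N) \<and> gens \<subseteq> N}"
  by (simp add: VL_lambda_sub_def lie_submodule_gen_def gens_def)

lemma ker_d_subset: "u \<in> ker_d U dom_d d \<Longrightarrow> u \<in> carrier U"
  using U.submoduleE(1)[OF dom_d] by (auto simp: ker_d_def)

lemma gens_closed: "gens \<subseteq> carrier V"
  using state_closed ker_d_subset VA.vac_closed by (auto simp: gens_def)

lemma gens_W: "gens \<subseteq> W"
  unfolding W_eq by blast

lemma W_subset: "W \<subseteq> carrier V"
  unfolding W_eq using VA.carrier_is_submodule act_closed gens_closed by blast

lemma submodule_W: "submodule W CC V"
proof (rule VA.submoduleI_add_smult[OF W_subset])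
  show "W \<noteq> {}"
    unfolding W_eq using submodule_zero_closed[OF VA.module_axioms] by blast
  show "s \<oplus>\<^bsub>V\<^esub> t \<in> W" if "s \<in> W" "t \<in> W" for s t
    using that VA.submoduleE(5) unfolding W_eq by blast
  show "c \<odot>\<^bsub>V\<^esub> t \<in> W" if "c \<in> carrier CC" "t \<in> W" for c t
    using that VA.submoduleE(4) unfolding W_eq by blast
qed

lemma W_act: "\<lbrakk>x \<in> carrier L; w \<in> W\<rbrakk> \<Longrightarrow> act x w \<in> W"
  unfolding W_eq by blast

lemma W_minimal:
  assumes N: "submodule N CC V"
    and "\<And>u n v. \<lbrakk>u \<in> carrier U; v \<in> N\<rbrakk> \<Longrightarrow> act (mode u n) v \<in> N" "gens \<subseteq> N"
  shows "W \<subseteq> N"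
  unfolding W_eq using act_stable[OF N assms(2)] assms by blast

lemma W_mode: "\<lbrakk>u \<in> carrier U; w \<in> W\<rbrakk> \<Longrightarrow> act (mode u n) w \<in> W"
  by (intro W_act umode_closed)

lemma W_add: "\<lbrakk>s \<in> W; t \<in> W\<rbrakk> \<Longrightarrow> s \<oplus>\<^bsub>V\<^esub> t \<in> W"
  by (rule VA.submoduleE(5)[OF submodule_W])

lemma W_smult: "s \<in> W \<Longrightarrow> c \<odot>\<^bsub>V\<^esub> s \<in> W"
  using VA.submoduleE(4)[OF submodule_W] by simp

text \<open>The vectors \<open>a\<close> with \<open>Y a n W \<subseteq> W\<close> for all
  \<open>n\<close> include the vacuum and are stable under the modes, because \<open>u(k) a =
  Y (u(-1) 1) k a\<close> is a product to which \<open>iterate_mem_submodule\<close> applies.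
  By cyclicity these are all vectors.\<close>

lemma Y_W_right:
  assumes a: "a \<in> carrier V" and w: "w \<in> W"
  shows "Y a n w \<in> W"
proof -
  define N where "N = {a \<in> carrier V. \<forall>n. \<forall>w\<in>W. Y a n w \<in> W}"
  have W: "w \<in> carrier V" if "w \<in> W" for w using that W_subset by blast
  have "a \<in> N"
  proof (rule cyclic)
    show "vac \<in> N"
      using VA.vac_closed W submodule_zero_closed[OF VA.module_axioms submodule_W]
      by (auto simp: N_def VA.vacuum)
    then show "submodule N CC V"
      by (intro VA.submoduleI_add_smult)
        (auto simp: N_def VA.Y_add_left VA.Y_smult_left W W_add W_smult)
  next
    fix u k v assume u: "u \<in> carrier U" and v: "v \<in> N"
    then have vV: "v \<in> carrier V" by (simp add: N_def)
    have "Y (Y (state u) k v) n w \<in> W" if w: "w \<in> W" for n w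
      using v w by (intro VA.iterate_mem_submodule submodule_W state_closed u vV W)
        (auto simp: N_def Y_state u W W_mode VA.Y_closed)
    then show "act (mode u k) v \<in> N"
      using act_closed[OF umode_closed[OF u] vV] by (simp add: N_def Y_state u vV)
  qed (rule a)
  then show ?thesis using w by (simp add: N_def)
qed

text \<open>A mode that vanishes in \<open>L\<close> acts as zero: each coefficient of the field of
  \<open>0(-1) 1\<close> is the action of the zero of \<open>L\<close>, and by truncation one
  of these coefficients annihilates \<open>v\<close>.\<close>

lemma act_zero:
  assumes v: "v \<in> carrier V"
  shows "act \<zero>\<^bsub>L\<^esub> v = \<zero>\<^bsub>V\<^esub>"
proof -
  have "\<rho> (\<lambda>n. 0 \<odot>\<^bsub>U\<^esub> lmonom U \<zero>\<^bsub>U\<^esub> k n) = 0 \<odot>\<^bsub>L\<^esub> \<rho> (lmonom U \<zero>\<^bsub>U\<^esub> k)" for k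
    by (intro rho_smult lmonom_closed) simp
  then have mode0: "mode \<zero>\<^bsub>U\<^esub> k = \<zero>\<^bsub>L\<^esub>" for k
    using L.smult_l_null[of "\<rho> (lmonom U \<zero>\<^bsub>U\<^esub> k)"] rho_closed[OF lmonom_closed, of "\<zero>\<^bsub>U\<^esub>" k]
      U.smult_r_null[of 0]
    by (simp add: umode_def lmonom_def if_distrib cong: if_cong)
  obtain N where "Y (state \<zero>\<^bsub>U\<^esub>) N v = \<zero>\<^bsub>V\<^esub>"
    using VA.truncation[OF state_closed v] by (metis U.zero_closed order_refl)
  then have "act (mode \<zero>\<^bsub>U\<^esub> N) v = \<zero>\<^bsub>V\<^esub>"
    using Y_state[OF U.zero_closed v, of N] by simp
  then show ?thesis by (simp only: mode0)
qed

text \<open>For \<open>d u = 0\<close>, the map \<open>d \<otimes> 1 + 1 \<otimes> d/dt\<close> sends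
  \<open>u t\<^bsup>n+1\<^esup> / (n+1)\<close> to \<open>u t\<^sup>n\<close>, which is
  therefore in the kernel of \<open>\<rho>\<close>.\<close>

lemma mode_ker_d:
  assumes u: "u \<in> ker_d U dom_d d" and n: "n \<noteq> - 1"
  shows "mode u n = \<zero>\<^bsub>L\<^esub>"
proof -
  have "of_int (n + 1) \<noteq> (0 :: complex)" unfolding of_int_eq_0_iff using n by linarith
  then obtain e :: complex where e: "of_int (n + 1) * e = 1"
    by (metis right_inverse)
  let ?p = "lmonom U (e \<odot>\<^bsub>U\<^esub> u) (n + 1)"
  have uU: "u \<in> carrier U" by (rule ker_d_subset[OF u])
  have u': "u \<in> dom_d" "d u = \<zero>\<^bsub>U\<^esub>" using u by (auto simp: ker_d_def)
  have zero: "\<zero>\<^bsub>U\<^esub> \<in> dom_d" by (rule submodule_zero_closed[OF U.module_axioms dom_d])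
  have cu: "e \<odot>\<^bsub>U\<^esub> u \<in> dom_d" using U.submoduleE(4)[OF dom_d] u' by simp
  have d_smult: "d (z \<odot>\<^bsub>U\<^esub> x) = z \<odot>\<^bsub>U\<^esub> d x" if "x \<in> dom_d" for z x
    using d_linear that by (simp add: linear_map_def)
  have dcu: "d (e \<odot>\<^bsub>U\<^esub> u) = \<zero>\<^bsub>U\<^esub>"
    using d_smult[OF u'(1), of e] u'(2) U.smult_r_null[of e] by simp
  have d0: "d \<zero>\<^bsub>U\<^esub> = \<zero>\<^bsub>U\<^esub>"
    using d_smult[OF u'(1), of 0] u'(2) U.smult_l_null[OF uU] U.smult_r_null[of 0] by simp
  have "?p \<in> carrier (laurent (U\<lparr>carrier := dom_d\<rparr>))"
    using zero cu by (auto simp: laurent_def lmonom_def)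
  moreover have "dhat U d ?p = lmonom U u n"
  proof
    fix m
    have "d (?p m) = \<zero>\<^bsub>U\<^esub>" using dcu d0 by (simp add: lmonom_def)
    moreover have "of_int (m + 1) \<odot>\<^bsub>U\<^esub> ?p (m + 1) = lmonom U u n m"
    proof (cases "m = n")
      case True
      then show ?thesis
        using U.smult_assoc1[of "of_int (n + 1)" e u] uU e U.smult_one[OF uU]
        by (simp add: lmonom_def)
    next
      case False
      then show ?thesis using U.smult_r_null[of "of_int (m + 1)"] by (simp add: lmonom_def)
    qed
    ultimately show "dhat U d ?p m = lmonom U u n m"
      using uU by (simp add: dhat_def lmonom_def)
  qed
  ultimately have "lmonom U u n \<in> dhat U d ` carrier (laurent (U\<lparr>carrier := dom_d\<rparr>))"
    by (metis image_eqI)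
  then show ?thesis
    using rho_ker by (auto simp: umode_def)
qed

text \<open>The operator \<open>T = u(-1) - \<lambda>(u)\<close> commutes with all modes on
  \<open>V\<close>, by the commutator formula and the vanishing of \<open>u(i)\<close> for
  \<open>i \<ge> 0\<close>. As it maps the vacuum to a generator of \<open>W\<close> and
  \<open>W\<close> is a submodule, cyclicity shows that it maps \<open>V\<close> into
  \<open>W\<close>.\<close>

lemma central_shift_mem:
  assumes u: "u \<in> ker_d U dom_d d" and a: "a \<in> carrier V"
  shows "act (mode u (- 1)) a \<ominus>\<^bsub>V\<^esub> lam u \<odot>\<^bsub>V\<^esub> a \<in> W"
proof -
  define T where "T = (\<lambda>a. Y (state u) (- 1) a \<oplus>\<^bsub>V\<^esub> (- lam u) \<odot>\<^bsub>V\<^esub> a)"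
  define N where "N = {a \<in> carrier V. T a \<in> W}"
  have uU: "u \<in> carrier U" by (rule ker_d_subset[OF u])
  have T_eq: "T a = act (mode u (- 1)) a \<ominus>\<^bsub>V\<^esub> lam u \<odot>\<^bsub>V\<^esub> a" if "a \<in> carrier V" for a
    using that by (simp add: T_def Y_state uU VA.minus_smult)
  have sc: "Y (state u) (- 1) a \<in> carrier V" if "a \<in> carrier V" for a
    by (intro VA.Y_closed state_closed uU that)
  have "a \<in> N"
  proof (rule cyclic)
    show vacN: "vac \<in> N"
      using gens_W u VA.vac_closed by (auto simp: N_def gens_def T_eq)
    show "submodule N CC V"
    proof (rule VA.submoduleI_add_smult)
      fix s t assume "s \<in> N" "t \<in> N"
      then have s: "s \<in> carrier V" "T s \<in> W" and t: "t \<in> carrier V" "T t \<in> W"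
        by (simp_all add: N_def)
      have "T (s \<oplus>\<^bsub>V\<^esub> t) = T s \<oplus>\<^bsub>V\<^esub> T t"
        using s(1) t(1) sc[OF s(1)] sc[OF t(1)]
        by (simp add: T_def VA.Y_add_right state_closed uU VA.smult_r_distr VA.M.add.m_ac)
      then show "s \<oplus>\<^bsub>V\<^esub> t \<in> N" using s t W_add by (simp add: N_def)
    next
      fix c s assume "s \<in> N"
      then have s: "s \<in> carrier V" "T s \<in> W" by (simp_all add: N_def)
      have "T (c \<odot>\<^bsub>V\<^esub> s) = c \<odot>\<^bsub>V\<^esub> T s"
        using s(1) sc[OF s(1)] VA.smult_assoc1[of c "- lam u" s] VA.smult_assoc1[of "- lam u" c s]
        by (simp add: T_def VA.Y_smult_right state_closed uU VA.smult_r_distr mult.commute)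
      then show "c \<odot>\<^bsub>V\<^esub> s \<in> N" using s W_smult by (simp add: N_def)
    qed (use vacN in \<open>auto simp: N_def\<close>)
  next
    fix v n a assume v: "v \<in> carrier U" and "a \<in> N"
    then have a: "a \<in> carrier V" "T a \<in> W" by (simp_all add: N_def)
    have "Y (state u) i (state v) = \<zero>\<^bsub>V\<^esub>" if "i \<ge> 0" for i
      using that mode_ker_d[OF u, of i] by (simp add: Y_state uU state_closed v act_zero)
    then have comm: "Y (state u) (- 1) (Y (state v) n a) = Y (state v) n (Y (state u) (- 1) a)"
      by (intro VA.modes_commute state_closed uU v a(1))
    have vc: "Y (state v) n a \<in> carrier V"
      by (intro VA.Y_closed state_closed v a(1))
    have "T (Y (state v) n a) = Y (state v) n (T a)"
      using a(1) sc[OF a(1)] by (simp add: T_def comm VA.Y_add_right VA.Y_smult_right state_closed v)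
    also have "\<dots> \<in> W"
      by (intro Y_W_right state_closed v a(2))
    finally show "act (mode v n) a \<in> N"
      using a(1) vc v by (simp add: N_def Y_state)
  qed (rule a)
  then show ?thesis using a by (simp add: N_def T_eq)
qed

text \<open>The vectors \<open>w \<in> W\<close> with \<open>Y w n V \<subseteq> W\<close> for all
  \<open>n\<close> form a submodule: in the iterate formula for \<open>Y (u(k) w) n a\<close>,
  one kind of term is a mode applied to \<open>Y w k' a \<in> W\<close>, the other is \<open>Y
  w k\<close> applied to some vector. It contains each generator, because its field is the
  constant operator \<open>u(-1) - \<lambda>(u)\<close>.\<close>

lemma Y_W_left:
  assumes w: "w \<in> W" and a: "a \<in> carrier V"
  shows "Y w n a \<in> W"
proof -
  define N where "N = {w \<in> W. \<forall>a\<in>carrier V. \<forall>n. Y w n a \<in> W}"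
  have W: "w \<in> carrier V" if "w \<in> W" for w using that W_subset by blast
  have zeroW: "\<zero>\<^bsub>V\<^esub> \<in> W" by (rule submodule_zero_closed[OF VA.module_axioms submodule_W])
  have "W \<subseteq> N"
  proof (rule W_minimal)
    have "\<zero>\<^bsub>V\<^esub> \<in> N" using zeroW by (simp add: N_def VA.Y_zero_left)
    then show "submodule N CC V"
      by (intro VA.submoduleI_add_smult)
        (auto simp: N_def VA.Y_add_left VA.Y_smult_left W W_add W_smult)
  next
    fix u k w assume u: "u \<in> carrier U" and wN: "w \<in> N"
    then have w: "w \<in> W" "w \<in> carrier V" using W by (simp_all add: N_def)
    have "Y (Y (state u) k w) n a \<in> W" if a: "a \<in> carrier V" for n a
      using wN a by (intro VA.iterate_mem_submodule submodule_W state_closed u w)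
        (simp_all add: N_def Y_W_right state_closed u VA.Y_closed)
    then show "act (mode u k) w \<in> N"
      using W_mode[OF u w(1)] w by (simp add: N_def Y_state u)
  next
    show "gens \<subseteq> N"
    proof
      fix g assume g: "g \<in> gens"
      then obtain u where u: "u \<in> ker_d U dom_d d" and g_eq: "g = state u \<ominus>\<^bsub>V\<^esub> lam u \<odot>\<^bsub>V\<^esub> vac"
        by (auto simp: gens_def)
      have uU: "u \<in> carrier U" by (rule ker_d_subset[OF u])
      have "Y g n a \<in> W" if a: "a \<in> carrier V" for n a
      proof -
        have "Y g n a = act (mode u n) a \<ominus>\<^bsub>V\<^esub> lam u \<odot>\<^bsub>V\<^esub> Y vac n a"
          unfolding g_eq using uU a
          by (simp add: VA.minus_smult VA.Y_add_left VA.Y_smult_left state_closed VA.vac_closed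
              VA.Y_closed Y_state)
        also have "\<dots> \<in> W"
        proof (cases "n = - 1")
          case True
          then show ?thesis using central_shift_mem[OF u a] a by (simp add: VA.vacuum)
        next
          case False
          then show ?thesis
            using mode_ker_d[OF u False] a act_zero[OF a] zeroW VA.smult_r_null[of "lam u"]
            by (simp add: VA.vacuum submodule_minus_closed[OF VA.module_axioms submodule_W])
        qed
        finally show ?thesis .
      qed
      then show "g \<in> N" using g gens_W by (auto simp: N_def)
    qed
  qed
  then show ?thesis using w a by (auto simp: N_def)
qed

theorem va_ideal_W: "va_ideal V Y W"
  unfolding va_ideal_def using submodule_W Y_W_left Y_W_right by blast

end

theorem corollary4p9:
  fixes L :: "(complex, 'l) module" and br :: "'l \<Rightarrow> 'l \<Rightarrow> 'l"
    and U :: "(complex, 'u) module" and dom_d :: "'u set" and d :: "'u \<Rightarrow> 'u"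
    and \<rho> :: "(int \<Rightarrow> 'u) \<Rightarrow> 'l" and lam :: "'u \<Rightarrow> complex"
    and Y :: "'l induced \<Rightarrow> int \<Rightarrow> 'l induced \<Rightarrow> 'l induced"
  assumes "local_vertex_lie_algebra L br U dom_d d \<rho>"
    and "linear_functional (U\<lparr>carrier := ker_d U dom_d d\<rparr>) lam"
    and "is_VL_vertex_structure L br U \<rho> Y"
  shows "va_ideal (VL L br U \<rho>) Y (VL_lambda_sub L br U dom_d d \<rho> lam) \<and>
         vertex_algebra (VL_lambda L br U dom_d d \<rho> lam)
           (quot_Y (VL L br U \<rho>) Y (VL_lambda_sub L br U dom_d d \<rho> lam))
           (VL_lambda_sub L br U dom_d d \<rho> lam +>\<^bsub>VL L br U \<rho>\<^esub> VL_vac L br U \<rho>)"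
proof -
  interpret VL_vertex_structure L br U dom_d d \<rho> Y lam
    using assms by (intro VL_vertex_structure.intro VL_vertex_structure_axioms.intro)
  have "vertex_algebra_ideal V Y vac W"
    by (intro vertex_algebra_ideal.intro VA.vertex_algebra_axioms vertex_algebra_ideal_axioms.intro
        va_ideal_W)
  from va_ideal_W vertex_algebra_ideal.quotient_vertex_algebra[OF this] show ?thesis
    by (simp add: VL_lambda_def)
qed

end
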